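(* Let $(X,\mathcal{A},m)$ be a non-atomic Lebesgue probability space and let $T$ be an ergodic automorphism of $(X,\mathcal{A},m)$. Equip $\mathcal{A}$ with the metric $d(A,B)=m(A\,\triangle\,B)$. Then the set of $A\in\mathcal{A}$ with $m(A)>0$ for which the induced transformation $T_A$ is weakly mixing is residual in $(\mathcal{A},d)$.
   Context: A non-atomic Lebesgue probability space is a standard non-atomic probability space (isomorphic mod null sets to $[0,1]$ with Lebesgue measure). Measurable sets that agree up to a set of measure zero are identified, so $\mathcal{A}$ denotes the measure algebra, and $(\mathcal{A},d)$ is a complete separable metric space. An automorphism $T$ of $(X,\mathcal{A},m)$ is an invertible (mod null sets) bi-measurable map $T:X\to X$ with $m(T(A))=m(A)$ for all $A\in\mathcal{A}$; it is ergodic if $\emptyset$ and $X$ are the only elements $A\in\mathcal{A}$ with $T(A)=A$ (mod null sets). For $A\in\mathcal{A}$ with $m(A)>0$, the induced transformation (first return map) is $T_A:A\to A$, $T_A(x)=T^{n(x)}(x)$ with $n(x)=\min\{n\ge 1: T^n(x)\in A\}$, defined for almost every $x\in A$; it preserves the normalized probability measure $m(\cdot\cap A)/m(A)$ on $A$, and weak mixing of $T_A$ is with respect to this measure (equivalently, the unitary Koopman operator $f\mapsto f\circ T_A$ has no eigenvectors in the orthogonal complement of the constant functions in $L^2(A)$). A subset is residual if its complement is meager, i.e. a countable union of nowhere dense sets. *)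

theory Defs
  imports "HOL-Analysis.Analysis" "HOL-Probability.Probability_Measure"
begin

section \<open>Non-atomic Lebesgue probability spaces\<close>

definition iso_mod_null :: "'a measure \<Rightarrow> 'b measure \<Rightarrow> bool" where
  "iso_mod_null M N \<longleftrightarrow>
     (\<exists>X Y \<phi>. X \<in> sets M \<and> space M - X \<in> null_sets M \<and>
        Y \<in> sets N \<and> space N - Y \<in> null_sets N \<and>
        bij_betw \<phi> X Y \<and>
        (\<forall>A\<subseteq>X. A \<in> sets M \<longleftrightarrow> \<phi> ` A \<in> sets N) \<and>
        (\<forall>A\<subseteq>X. A \<in> sets M \<longrightarrow> emeasure N (\<phi> ` A) = emeasure M A))"

text \<open>
  The completion covers both conventions in use: for a complete space it changes nothing, and
  it also admits standard Borel spaces, which are not isomorphic to the Lebesgue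
  \<open>\<sigma>\<close>-algebra itself.
\<close>

definition nonatomic_lebesgue_prob_space :: "'a measure \<Rightarrow> bool" where
  "nonatomic_lebesgue_prob_space M \<longleftrightarrow>
     prob_space M \<and> iso_mod_null (completion M) (lebesgue_on {0..1::real})"

section \<open>Automorphisms and ergodicity\<close>

text \<open>
  \<open>T\<close> is only invertible modulo null sets, so images under \<open>T\<close> are taken of subsets of a conull
  set \<open>D\<close> on which \<open>T\<close> is injective: the raw image of a null set outside \<open>D\<close> may fail to be
  null. \<open>T ` (A \<inter> D)\<close> represents \<open>T(A)\<close>, up to a null set independently of \<open>D\<close>. Since \<open>T ` D\<close>
  has full measure, surjectivity modulo null sets is implied.
\<close>

definition invertibility_domain :: "'a measure \<Rightarrow> ('a \<Rightarrow> 'a) \<Rightarrow> 'a set \<Rightarrow> bool" where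
  "invertibility_domain M T D \<longleftrightarrow>
     D \<in> sets M \<and> space M - D \<in> null_sets M \<and> inj_on T D \<and>
     (\<forall>A\<in>sets M. T ` (A \<inter> D) \<in> sets M \<and> emeasure M (T ` (A \<inter> D)) = emeasure M A)"

definition automorphism :: "'a measure \<Rightarrow> ('a \<Rightarrow> 'a) \<Rightarrow> bool" where
  "automorphism M T \<longleftrightarrow> T \<in> M \<rightarrow>\<^sub>M M \<and> (\<exists>D. invertibility_domain M T D)"

definition ergodic :: "'a measure \<Rightarrow> ('a \<Rightarrow> 'a) \<Rightarrow> bool" where
  "ergodic M T \<longleftrightarrow>
     (\<forall>D A. invertibility_domain M T D \<and> A \<in> sets M \<and> sym_diff (T ` (A \<inter> D)) A \<in> null_sets M
        \<longrightarrow> A \<in> null_sets M \<or> space M - A \<in> null_sets M)"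

section \<open>The measure algebra as a metric space\<close>

definition null_eq :: "'a measure \<Rightarrow> ('a set \<times> 'a set) set" where
  "null_eq M = {(A, B). A \<in> sets M \<and> B \<in> sets M \<and> sym_diff A B \<in> null_sets M}"

definition measure_algebra :: "'a measure \<Rightarrow> 'a set set set" where
  "measure_algebra M = sets M // null_eq M"

definition null_class :: "'a measure \<Rightarrow> 'a set \<Rightarrow> 'a set set" where
  "null_class M A = null_eq M `` {A}"

definition algebra_dist :: "'a measure \<Rightarrow> 'a set set \<Rightarrow> 'a set set \<Rightarrow> real" where
  "algebra_dist M a b = measure M (sym_diff (SOME A. A \<in> a) (SOME B. B \<in> b))"

definition algebra_topology :: "'a measure \<Rightarrow> 'a set set topology" where
  "algebra_topology M = Metric_space.mtopology (measure_algebra M) (algebra_dist M)"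

lemma equiv_null_eq: "equiv (sets M) (null_eq M)"
proof (rule equivI)
  show "null_eq M \<subseteq> sets M \<times> sets M" "refl_on (sets M) (null_eq M)" "sym (null_eq M)"
    by (auto simp: null_eq_def refl_on_def sym_def Un_commute)
  show "trans (null_eq M)"
  proof (rule transI)
    fix A B C assume *: "(A, B) \<in> null_eq M" "(B, C) \<in> null_eq M"
    then have "sym_diff A B \<union> sym_diff B C \<in> null_sets M"
      by (auto simp: null_eq_def)
    moreover have "sym_diff A C \<subseteq> sym_diff A B \<union> sym_diff B C" by blast
    ultimately have "sym_diff A C \<in> null_sets M"
      using * by (elim null_sets_subset) (auto simp: null_eq_def)
    with * show "(A, C) \<in> null_eq M" by (auto simp: null_eq_def)
  qed
qed

context finite_measure
begin

lemma measure_sym_diff_triangle: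
  assumes "A \<in> sets M" "B \<in> sets M" "C \<in> sets M"
  shows "measure M (sym_diff A C) \<le> measure M (sym_diff A B) + measure M (sym_diff B C)"
proof -
  have "measure M (sym_diff A C) \<le> measure M (sym_diff A B \<union> sym_diff B C)"
    using assms by (intro finite_measure_mono) auto
  also have "\<dots> \<le> measure M (sym_diff A B) + measure M (sym_diff B C)"
    using assms by (intro measure_Un_le) auto
  finally show ?thesis .
qed

lemma algebra_dist_null_class:
  assumes "A \<in> sets M" "B \<in> sets M"
  shows "algebra_dist M (null_class M A) (null_class M B) = measure M (sym_diff A B)"
proof -
  have eq: "measure M (sym_diff A' B') = measure M (sym_diff A B)"
    if "A' \<in> null_class M A" "B' \<in> null_class M B" for A' B'
  proof -
    have "A' \<in> sets M" "B' \<in> sets M"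
      and "measure M (sym_diff A A') = 0" "measure M (sym_diff B B') = 0"
      using that by (auto simp: null_class_def null_eq_def measure_def null_setsD1)
    then show ?thesis
      using measure_sym_diff_triangle[of A' A B'] measure_sym_diff_triangle[of A B B']
        measure_sym_diff_triangle[of A A' B] measure_sym_diff_triangle[of A' B' B] assms
      by (simp add: Un_commute)
  qed
  have "A \<in> null_class M A" "B \<in> null_class M B"
    using assms by (auto simp: null_class_def null_eq_def)
  then have "(SOME A'. A' \<in> null_class M A) \<in> null_class M A"
    "(SOME B'. B' \<in> null_class M B) \<in> null_class M B"
    by (auto intro: someI)
  with eq show ?thesis
    by (simp add: algebra_dist_def)
qed

lemma null_class_eq_iff:
  assumes "A \<in> sets M" "B \<in> sets M"
  shows "null_class M A = null_class M B \<longleftrightarrow> measure M (sym_diff A B) = 0"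
proof -
  have "null_class M A = null_class M B \<longleftrightarrow> (A, B) \<in> null_eq M"
    using eq_equiv_class_iff[OF equiv_null_eq assms] by (simp add: null_class_def)
  also have "\<dots> \<longleftrightarrow> measure M (sym_diff A B) = 0"
    using assms by (auto simp: null_eq_def null_sets_def emeasure_eq_measure)
  finally show ?thesis .
qed

lemma Metric_space_measure_algebra: "Metric_space (measure_algebra M) (algebra_dist M)"
proof
  have rep: "\<exists>A\<in>sets M. a = null_class M A" if "a \<in> measure_algebra M" for a
    using that by (auto simp: measure_algebra_def null_class_def elim: quotientE)
  show "0 \<le> algebra_dist M a b" "algebra_dist M a b = algebra_dist M b a" for a b
    by (simp_all add: algebra_dist_def Un_commute)
  show "algebra_dist M a b = 0 \<longleftrightarrow> a = b"
    if "a \<in> measure_algebra M" "b \<in> measure_algebra M" for a b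
    using rep[OF that(1)] rep[OF that(2)] algebra_dist_null_class null_class_eq_iff by metis
  show "algebra_dist M a c \<le> algebra_dist M a b + algebra_dist M b c"
    if "a \<in> measure_algebra M" "b \<in> measure_algebra M" "c \<in> measure_algebra M" for a b c
    using rep[OF that(1)] rep[OF that(2)] rep[OF that(3)]
    by (auto simp: algebra_dist_null_class intro: measure_sym_diff_triangle)
qed

end

section \<open>Residual sets\<close>

definition nowhere_dense_in :: "'a topology \<Rightarrow> 'a set \<Rightarrow> bool" where
  "nowhere_dense_in X S \<longleftrightarrow> S \<subseteq> topspace X \<and> X interior_of (X closure_of S) = {}"

definition meager_in :: "'a topology \<Rightarrow> 'a set \<Rightarrow> bool" where
  "meager_in X S \<longleftrightarrow> (\<exists>\<N>. countable \<N> \<and> (\<forall>N\<in>\<N>. nowhere_dense_in X N) \<and> S = \<Union>\<N>)"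

definition residual_in :: "'a topology \<Rightarrow> 'a set \<Rightarrow> bool" where
  "residual_in X S \<longleftrightarrow> S \<subseteq> topspace X \<and> meager_in X (topspace X - S)"

section \<open>Induced transformations and weak mixing\<close>

definition return_time :: "('a \<Rightarrow> 'a) \<Rightarrow> 'a set \<Rightarrow> 'a \<Rightarrow> nat" where
  "return_time T A x = (LEAST n. 1 \<le> n \<and> (T ^^ n) x \<in> A)"

definition induced :: "('a \<Rightarrow> 'a) \<Rightarrow> 'a set \<Rightarrow> 'a \<Rightarrow> 'a" where
  "induced T A x = (T ^^ return_time T A x) x"

definition normalized_on :: "'a measure \<Rightarrow> 'a set \<Rightarrow> 'a measure" where
  "normalized_on M A = scale_measure (inverse (emeasure M A)) (restrict_space M A)"

text \<open>
  The Koopman operator \<open>f \<mapsto> f \<circ> S\<close> on complex \<open>L\<^sup>2(N)\<close> has no eigenvector orthogonal to the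
  constants. The almost-everywhere equation makes sense for a map \<open>S\<close> that is defined and
  measure preserving only almost everywhere, as \<open>induced T A\<close> is.
\<close>

definition weakly_mixing :: "'a measure \<Rightarrow> ('a \<Rightarrow> 'a) \<Rightarrow> bool" where
  "weakly_mixing N S \<longleftrightarrow>
     \<not> (\<exists>(f :: 'a \<Rightarrow> complex) c. f \<in> borel_measurable N \<and> integrable N (\<lambda>x. (norm (f x))\<^sup>2) \<and>
          \<not> (AE x in N. f x = 0) \<and> (\<integral>x. f x \<partial>N) = 0 \<and>
          (AE x in N. f (S x) = c * f x))"

end

theory Submission
  imports Defs
begin

text \<open>
  An eigenfunction of \<open>T\<^sub>A\<close> with eigenvalue \<open>c\<close> extends along orbits to a function \<open>g\<close> on the whole
  space with \<open>g (T x) = c\<^bsup>1\<^sub>A(T x)\<^esup> g x\<close>; by ergodicity \<open>|g|\<close> is constant and \<open>|c| = 1\<close>. Hence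
  \<open>g (T\<^sup>n x) = c\<^bsup>S n x\<^esup> g x\<close>, where \<open>S n x\<close> counts the visits of \<open>T x, \<dots>, T\<^sup>n x\<close> to \<open>A\<close>. If the
  correlations \<open>\<integral> 1\<^sub>H (1\<^sub>H \<circ> T\<^sup>n) c\<^bsup>S n\<^esup>\<close> are small for sufficiently many \<open>n\<close>, almost orthogonality forces
  \<open>\<integral>\<^sub>H g\<close> to be small. Asking for this smallness uniformly in \<open>|c - 1| \<ge> \<delta>\<close> is an open condition
  on \<open>A\<close>, and countably many sets \<open>H\<close> and constants \<open>\<delta>\<close> suffice to exclude all eigenvalues \<open>c \<noteq> 1\<close>.

  The condition is also dense: cut the space into tiny pieces and exchange \<open>A\<close> with its complement
  on each of them independently with a small probability \<open>e\<close>. As \<open>T\<close> is aperiodic, almost all orbit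
  segments of length \<open>n\<close> run through distinct pieces, so the mean of \<open>c\<^bsup>S n\<^esup>\<close> decays exponentially in \<open>n\<close>. A
  second moment estimate and a finite net of values \<open>c\<close> yield one choice that works for all \<open>c\<close>.
\<close>

section \<open>The topology of the measure algebra and ergodicity\<close>

text \<open>Category criterion on representatives: by \<open>dense\<close>, every ball contains a
  smaller ball on which \<open>P q\<close> holds, so the classes violating \<open>P q\<close> are
  nowhere dense, and countably many conditions leave a meager exceptional set.\<close>

lemma (in finite_measure) residual_in_algebra_topologyI:
  assumes Q: "countable Q"
    and dense: "\<And>q A e. \<lbrakk>q \<in> Q; A \<in> sets M; e > 0\<rbrakk> \<Longrightarrow>
      \<exists>B\<in>sets M. measure M (sym_diff A B) < e \<and>
        (\<exists>d>0. \<forall>C\<in>sets M. measure M (sym_diff B C) < d \<longrightarrow> P q C)"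
    and good: "\<And>A. A \<in> sets M \<Longrightarrow> (\<And>q. q \<in> Q \<Longrightarrow> P q A) \<Longrightarrow> Good A"
  shows "residual_in (algebra_topology M) {null_class M A | A. A \<in> sets M \<and> Good A}"
proof -
  interpret Metric_space "measure_algebra M" "algebra_dist M"
    by (rule Metric_space_measure_algebra)
  define S where "S = {null_class M A | A. A \<in> sets M \<and> Good A}"
  \<comment> \<open>\<open>Good\<close> need not imply every \<open>P q\<close>, nor is
    \<open>P q\<close> assumed to be invariant under null changes; removing \<open>S\<close> makes
    the union of the \<open>N q\<close> exactly the complement of \<open>S\<close>.\<close>
  define N where "N q = {null_class M A | A. A \<in> sets M \<and> \<not> P q A} - S" for q
  have top: "topspace (algebra_topology M) = measure_algebra M"
    by (simp add: algebra_topology_def)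
  have rep: "a \<in> measure_algebra M \<longleftrightarrow> (\<exists>A\<in>sets M. a = null_class M A)" for a
    by (auto simp: measure_algebra_def null_class_def quotient_def)
  have "nowhere_dense_in (algebra_topology M) (N q)" if q: "q \<in> Q" for q
  proof -
    have False if a: "a \<in> mtopology interior_of (mtopology closure_of N q)" for a
    proof -
      obtain e where e: "e > 0" "mball a e \<subseteq> mtopology closure_of N q" and "a \<in> measure_algebra M"
        using a unfolding metric_interior_of by blast
      then obtain A where A: "A \<in> sets M" "a = null_class M A" using rep by blast
      obtain B d where B: "B \<in> sets M" "measure M (sym_diff A B) < e" "d > 0"
        "\<And>C. C \<in> sets M \<Longrightarrow> measure M (sym_diff B C) < d \<Longrightarrow> P q C"
        using dense[OF q A(1) e(1)] by blast
      have "null_class M B \<in> mball a e"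
        using A B rep by (auto simp: algebra_dist_null_class)
      then have "null_class M B \<in> mtopology closure_of N q" using e by blast
      then obtain b where b: "b \<in> N q" "b \<in> mball (null_class M B) d"
        using \<open>d > 0\<close> unfolding metric_closure_of by blast
      then obtain C where "C \<in> sets M" "\<not> P q C" "b = null_class M C"
        by (auto simp: N_def)
      with b B show False by (auto simp: algebra_dist_null_class)
    qed
    moreover have "N q \<subseteq> topspace (algebra_topology M)"
      unfolding top using rep by (auto simp: N_def)
    ultimately show ?thesis
      by (auto simp: nowhere_dense_in_def algebra_topology_def)
  qed
  moreover have "measure_algebra M - S = (\<Union>q\<in>Q. N q)"
    using good by (fastforce simp: N_def S_def rep)
  ultimately have "meager_in (algebra_topology M) (measure_algebra M - S)"
    unfolding meager_in_def using Q by (intro exI[of _ "N ` Q"]) auto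
  then show ?thesis
    unfolding residual_in_def top S_def[symmetric] using rep by (auto simp: S_def)
qed

text \<open>The Lebesgue structure enters only through a real coordinate \<open>\<psi>\<close>: it
  gives no interval more mass than its length, and modulo null sets every measurable set is the
  preimage of a Borel set. Ergodicity is phrased with preimages, so that no images under an almost
  everywhere invertible map occur.\<close>

locale uniform_ergodic = prob_space M for M :: "'a measure" +
  fixes T :: "'a \<Rightarrow> 'a" and \<psi> :: "'a \<Rightarrow> real"
  assumes T_meas [measurable]: "T \<in> M \<rightarrow>\<^sub>M M"
    and distr_T: "distr M M T = M"
    and erg: "\<And>A. A \<in> sets M \<Longrightarrow> (AE x in M. T x \<in> A \<longleftrightarrow> x \<in> A) \<Longrightarrow>
      (AE x in M. x \<in> A) \<or> (AE x in M. x \<notin> A)"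
    and \<psi>_meas [measurable]: "\<psi> \<in> borel_measurable M"
    and \<psi>_range: "AE x in M. \<psi> x \<in> {0..1}"
    and \<psi>_unif: "\<And>a b. a \<le> b \<Longrightarrow> measure M {x \<in> space M. \<psi> x \<in> {a..b}} \<le> b - a"
    and \<psi>_gen: "\<And>E. E \<in> sets M \<Longrightarrow> \<exists>C\<in>sets borel. AE x in M. x \<in> E \<longleftrightarrow> \<psi> x \<in> C"
begin

section \<open>Invariance of the measure under iterates; ergodicity for sets and functions\<close>

lemma funpow_meas [measurable]: "(T ^^ n) \<in> M \<rightarrow>\<^sub>M M"
  by (induction n) (auto intro: measurable_compose simp: measurable_ident_sets comp_def)

lemma distr_funpow: "distr M M (T ^^ n) = M"
proof (induction n)
  case 0
  then show ?case by (simp add: distr_id id_def)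
next
  case (Suc n)
  have "distr M M (T ^^ Suc n) = distr (distr M M (T ^^ n)) M T"
    by (subst distr_distr) (simp_all add: comp_def)
  then show ?case by (simp only: Suc distr_T)
qed

lemma AE_funpow:
  assumes "AE x in M. P x"
  shows "AE x in M. P ((T ^^ n) x)"
  using AE_distrD[OF funpow_meas[of n], of P] assms by (simp only: distr_funpow)

lemma integral_funpow:
  fixes f :: "'a \<Rightarrow> 'b::{banach, second_countable_topology}"
  assumes "f \<in> borel_measurable M"
  shows "(\<integral>x. f ((T ^^ n) x) \<partial>M) = (\<integral>x. f x \<partial>M)"
  using integral_distr[OF funpow_meas[of n] assms] distr_funpow by simp

lemma measure_funpow:
  assumes [measurable]: "A \<in> sets M"
  shows "measure M {x \<in> space M. (T ^^ n) x \<in> A} = measure M A"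
proof -
  have "measure M A = measure (distr M M (T ^^ n)) A" by (simp add: distr_funpow)
  also have "\<dots> = measure M ((T ^^ n) -` A \<inter> space M)" by (simp add: measure_distr)
  also have "(T ^^ n) -` A \<inter> space M = {x \<in> space M. (T ^^ n) x \<in> A}" by auto
  finally show ?thesis by simp
qed

lemma AE_iff_if_imp:
  assumes [measurable]: "A \<in> sets M" "B \<in> sets M"
    and imp: "AE x in M. x \<in> A \<longrightarrow> x \<in> B" and eq: "measure M A = measure M B"
  shows "AE x in M. x \<in> A \<longleftrightarrow> x \<in> B"
proof -
  have "measure M (A \<inter> B) = measure M A"
    using imp by (intro measure_eq_AE) auto
  then have "measure M (B - A) = 0"
    using eq finite_measure_Diff'[of B A] by (simp add: Int_commute)
  then have "B - A \<in> null_sets M" by (auto simp: null_sets_def emeasure_eq_measure)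
  then have "AE x in M. x \<notin> B - A" by (rule AE_not_in)
  with imp show ?thesis by eventually_elim auto
qed

text \<open>\<open>A\<close> and its preimage under \<open>T\<close> have equal measure, so an
  inclusion of one in the other modulo null sets is already an equality.\<close>

lemma erg_subset:
  assumes [measurable]: "A \<in> sets M"
    and "(AE x in M. x \<in> A \<longrightarrow> T x \<in> A) \<or> (AE x in M. T x \<in> A \<longrightarrow> x \<in> A)"
  shows "(AE x in M. x \<in> A) \<or> (AE x in M. x \<notin> A)"
proof (rule erg)
  let ?B = "{x \<in> space M. T x \<in> A}"
  have [simp]: "measure M ?B = measure M A" using measure_funpow[of A 1] by simp
  from assms(2) show "AE x in M. T x \<in> A \<longleftrightarrow> x \<in> A"
  proof
    assume "AE x in M. x \<in> A \<longrightarrow> T x \<in> A"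
    then have "AE x in M. x \<in> A \<longleftrightarrow> x \<in> ?B" by (intro AE_iff_if_imp) auto
    then show ?thesis using AE_space by eventually_elim auto
  next
    assume "AE x in M. T x \<in> A \<longrightarrow> x \<in> A"
    then have "AE x in M. x \<in> ?B \<longleftrightarrow> x \<in> A" by (intro AE_iff_if_imp) auto
    then show ?thesis using AE_space by eventually_elim auto
  qed
qed fact

text \<open>Each superlevel set of \<open>g\<close> satisfies the one-sided invariance of
  \<open>erg_subset\<close>, hence is null or conull. The constant is the supremum of the set
  \<open>U\<close> of levels exceeded almost everywhere.\<close>

lemma erg_const:
  fixes g :: "'a \<Rightarrow> real"
  assumes [measurable]: "g \<in> borel_measurable M"
    and "(AE x in M. g x \<le> g (T x)) \<or> (AE x in M. g (T x) \<le> g x)"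
  shows "\<exists>r. AE x in M. g x = r"
proof -
  have dich: "(AE x in M. g x > t) \<or> (AE x in M. g x \<le> t)" for t
  proof -
    have "(AE x in M. x \<in> {x\<in>space M. g x > t}) \<or> (AE x in M. x \<notin> {x\<in>space M. g x > t})"
    proof (rule erg_subset)
      have sp: "AE x in M. T x \<in> space M" using measurable_space[OF T_meas] by auto
      show "(AE x in M. x \<in> {x\<in>space M. g x > t} \<longrightarrow> T x \<in> {x\<in>space M. g x > t}) \<or>
        (AE x in M. T x \<in> {x\<in>space M. g x > t} \<longrightarrow> x \<in> {x\<in>space M. g x > t})"
        using assms(2)
      proof
        assume "AE x in M. g x \<le> g (T x)"
        then have "AE x in M. x \<in> {x\<in>space M. g x > t} \<longrightarrow> T x \<in> {x\<in>space M. g x > t}"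
          using sp by eventually_elim auto
        then show ?thesis ..
      next
        assume "AE x in M. g (T x) \<le> g x"
        then have "AE x in M. T x \<in> {x\<in>space M. g x > t} \<longrightarrow> x \<in> {x\<in>space M. g x > t}"
          using AE_space by eventually_elim auto
        then show ?thesis ..
      qed
    qed measurable
    then show ?thesis
    proof
      assume "AE x in M. x \<in> {x\<in>space M. g x > t}"
      then have "AE x in M. g x > t" by eventually_elim auto
      then show ?thesis ..
    next
      assume "AE x in M. x \<notin> {x\<in>space M. g x > t}"
      then have "AE x in M. g x \<le> t" using AE_space by eventually_elim auto
      then show ?thesis ..
    qed
  qed
  define U where "U = {t. AE x in M. g x > t}"
  have "U \<noteq> {}"
  proof
    assume "U = {}"
    then have "AE x in M. \<forall>n::nat. g x \<le> - real n" using dich by (auto simp: U_def AE_all_countable)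
    then have "AE x in M. False"
    proof eventually_elim
      case (elim x)
      obtain n where "- g x < real n" using reals_Archimedean2 by blast
      with elim[rule_format, of n] show ?case by simp
    qed
    then show False by simp
  qed
  moreover have "bdd_above U"
  proof (rule ccontr)
    assume nb: "\<not> bdd_above U"
    have "AE x in M. g x > real n" for n
    proof -
      obtain t where "t \<in> U" "t > real n" using nb by (auto simp: bdd_above_def not_le)
      then show ?thesis by (auto simp: U_def elim!: AE_mp)
    qed
    then have "AE x in M. \<forall>n. g x > real n" by (simp add: AE_all_countable)
    then have "AE x in M. False"
    proof eventually_elim
      case (elim x)
      obtain n where "g x < real n" using reals_Archimedean2 by blast
      with elim[rule_format, of n] show ?case by simp
    qed
    then show False by simp
  qed
  ultimately have *: "AE x in M. \<forall>n. g x > Sup U - inverse (real (Suc n)) \<and> g x \<le> Sup U + inverse (real (Suc n))"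
  proof -
    assume U: "U \<noteq> {}" "bdd_above U"
    have "AE x in M. g x > Sup U - inverse (real (Suc n))" for n
    proof -
      obtain t where t: "t \<in> U" "t > Sup U - inverse (real (Suc n))"
        using less_cSupE[of "Sup U - inverse (real (Suc n))" U] U by auto
      then have "AE x in M. g x > t" by (simp add: U_def)
      then show ?thesis by eventually_elim (use t in linarith)
    qed
    moreover have "AE x in M. g x \<le> Sup U + inverse (real (Suc n))" for n
    proof -
      have "Sup U + inverse (real (Suc n)) \<notin> U"
        using cSup_upper[OF _ U(2), of "Sup U + inverse (real (Suc n))"] by auto
      then show ?thesis using dich by (auto simp: U_def)
    qed
    ultimately show ?thesis by (simp add: AE_all_countable)
  qed
  have "AE x in M. g x = Sup U"
    using *
  proof eventually_elim
    case (elim x)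
    show ?case
    proof (rule ccontr)
      assume "g x \<noteq> Sup U"
      then obtain n where "inverse (real (Suc n)) < \<bar>g x - Sup U\<bar>"
        using reals_Archimedean[of "\<bar>g x - Sup U\<bar>"] by auto
      with elim[rule_format, of n] show False by linarith
    qed
  qed
  then show ?thesis ..
qed

section \<open>Consequences of the coordinate: no atoms, a generating system, aperiodicity\<close>

lemma \<psi>_eq_null: "AE x in M. \<psi> x \<noteq> t"
proof -
  have "measure M {x \<in> space M. \<psi> x = t} \<le> 0"
    using \<psi>_unif[of t t] by simp
  then have "{x \<in> space M. \<psi> x = t} \<in> null_sets M"
    by (auto simp: null_sets_def emeasure_eq_measure measure_le_0_iff)
  then show ?thesis by (rule AE_I') auto
qed

text \<open>Half-lines with rational endpoints form an intersection-stable generator of the Borel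
  sets, so the integral of \<open>g\<close> vanishes over all preimages of Borel sets, which by
  \<open>\<psi>_gen\<close> are all measurable sets. Rational endpoints keep the family of test sets
  countable.\<close>

lemma AE_zero_if_integral_zero:
  fixes g :: "'a \<Rightarrow> complex"
  assumes g: "integrable M g"
    and z: "\<And>q. q \<in> \<rat> \<Longrightarrow> (\<integral>x. indicator {x. \<psi> x \<le> q} x *\<^sub>R g x \<partial>M) = 0"
  shows "AE x in M. g x = 0"
proof (rule density_zero[OF g])
  have gm [measurable]: "g \<in> borel_measurable M" using g by simp
  define I where "I C = (LINT x:{x \<in> space M. \<psi> x \<in> C}|M. g x)" for C
  have Im [measurable]: "{x \<in> space M. \<psi> x \<in> C} \<in> sets M" if "C \<in> sets borel" for C
    using that by measurable
  have int: "set_integrable M {x \<in> space M. \<psi> x \<in> C} g" if "C \<in> sets borel" for C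
    unfolding set_integrable_def using Im[OF that] g by (rule integrable_mult_indicator)
  have I_rat: "I {..q} = 0" if "q \<in> \<rat>" for q
  proof -
    have "I {..q} = (\<integral>x. indicator {x. \<psi> x \<le> q} x *\<^sub>R g x \<partial>M)"
      unfolding I_def set_lebesgue_integral_def
      by (rule Bochner_Integration.integral_cong) (auto simp: indicator_def)
    with z[OF that] show ?thesis by simp
  qed
  have sets_borel: "sets (borel :: real measure) = sigma_sets UNIV ((\<lambda>q. {..q}) ` \<rat>)"
  proof -
    let ?S = "sigma UNIV ((\<lambda>q::real. {..q}) ` \<rat>)"
    have "borel = ?S"
    proof (rule borel_eq_sigmaI1[OF borel_eq_atMost])
      fix X :: "real set" assume "X \<in> range atMost"
      then obtain t where t: "X = {..t}" by blast
      have "{..t} = (\<Inter>q\<in>{q\<in>\<rat>. t \<le> q}. {..q})"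
      proof (intro set_eqI iffI)
        fix x assume x: "x \<in> (\<Inter>q\<in>{q\<in>\<rat>. t \<le> q}. {..q})"
        show "x \<in> {..t}"
        proof (rule ccontr)
          assume "x \<notin> {..t}"
          then obtain q where "q \<in> \<rat>" "t < q" "q < x"
            using Rats_dense_in_real[of t x] by auto
          with x show False by force
        qed
      qed force
      also have "\<dots> \<in> sets ?S"
      proof (rule sets.countable_INT')
        show "{q\<in>\<rat>. t \<le> q} \<noteq> {}"
          using Rats_dense_in_real[of t "t+1"] by force
      qed (auto intro!: countable_subset[OF _ countable_rat])
      finally show "X \<in> sets ?S" by (simp add: t)
    qed auto
    then show ?thesis by (metis sets_measure_of subset_Pow_Union top_greatest Pow_UNIV)
  qed
  have I_borel: "I C = 0" if "C \<in> sets borel" for C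
  proof -
    have "Int_stable ((\<lambda>q::real. {..q}) ` \<rat>)"
      by (auto simp: Int_stable_def min_def)
    moreover have "(\<lambda>q::real. {..q}) ` \<rat> \<subseteq> Pow UNIV" by simp
    moreover have "C \<in> sigma_sets UNIV ((\<lambda>q. {..q}) ` \<rat>)" using that sets_borel by simp
    ultimately show ?thesis
    proof (induction rule: sigma_sets_induct_disjoint)
      case (compl A)
      then have [measurable]: "A \<in> sets borel" by (simp add: sets_borel)
      have "I A + I (UNIV - A) = I UNIV"
        unfolding I_def using int[of A] int[of "UNIV - A"]
        by (subst set_integral_Un[symmetric])
          (auto intro!: arg_cong[where f="\<lambda>X. set_lebesgue_integral M X g"])
      \<comment> \<open>The whole line is not a generator, but \<open>\<psi>\<close> is at most 1
        almost everywhere and 1 is rational.\<close>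
      also have "I UNIV = I {..1}"
        unfolding I_def set_lebesgue_integral_def
        using \<psi>_range by (intro integral_cong_AE) (auto simp: indicator_def)
      finally show ?case using compl I_rat by simp
    next
      case (union A)
      then have [measurable]: "A i \<in> sets borel" for i by (auto simp: sets_borel)
      have "I (\<Union>i. A i) = (LINT x:(\<Union>i. {x \<in> space M. \<psi> x \<in> A i})|M. g x)"
        unfolding I_def by (rule arg_cong[where f="\<lambda>X. set_lebesgue_integral M X g"]) auto
      also have "\<dots> = (\<Sum>i. I (A i))"
        unfolding I_def
      proof (rule lebesgue_integral_countable_add)
        have "(\<Union>i. {x \<in> space M. \<psi> x \<in> A i}) = {x \<in> space M. \<psi> x \<in> (\<Union>i. A i)}" by auto
        then show "set_integrable M (\<Union>i. {x \<in> space M. \<psi> x \<in> A i}) g"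
          using int[of "\<Union>i. A i"] by simp
      qed (use union(1) in \<open>auto simp: disjoint_family_on_def\<close>)
      also have "\<dots> = 0" using union by simp
      finally show ?case .
    qed (use I_rat in \<open>auto simp: I_def set_lebesgue_integral_def\<close>)
  qed
  fix A assume [measurable]: "A \<in> sets M"
  from \<psi>_gen[OF this] obtain C where [measurable]: "C \<in> sets borel"
    and C: "AE x in M. x \<in> A \<longleftrightarrow> \<psi> x \<in> C" by blast
  have "set_lebesgue_integral M A g = I C"
    unfolding I_def set_lebesgue_integral_def
    by (rule integral_cong_AE) (use C AE_space in \<open>auto simp: indicator_def elim!: AE_mp\<close>)
  then show "set_lebesgue_integral M A g = 0" using I_borel by simp
qed

text \<open>Otherwise the set \<open>W\<close> of coincidences has a part \<open>E j\<close> of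
  small positive measure that is invariant under the \<open>n\<close>-th iterate. The union of its
  first \<open>n\<close> preimages is then invariant under \<open>T\<close> but neither null nor
  conull.\<close>

lemma aperiodic:
  assumes n: "n \<ge> 1"
  shows "AE x in M. \<psi> ((T ^^ n) x) \<noteq> \<psi> x"
proof (rule ccontr)
  assume neg: "\<not> ?thesis"
  define W where "W = {x \<in> space M. \<psi> ((T ^^ n) x) = \<psi> x}"
  have [measurable]: "W \<in> sets M" unfolding W_def by measurable
  \<comment> \<open>With \<open>Suc n\<close> slices, \<open>n\<close> preimages of one slice have
    total measure at most \<open>n / Suc n\<close>, which is less than 1.\<close>
  define N where "N = Suc n"
  define E where "E j = {x \<in> W. \<psi> x \<in> {real j / N .. real (Suc j) / N}}" for j
  have E_meas [measurable]: "E j \<in> sets M" for j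
    unfolding E_def W_def by measurable
  have "\<exists>j<N. measure M (E j) \<noteq> 0"
  proof (rule ccontr)
    assume "\<not> ?thesis"
    then have "AE x in M. \<forall>j\<in>{..<N}. x \<notin> E j"
      by (intro AE_finite_allI AE_not_in) (auto simp: null_sets_def emeasure_eq_measure)
    then have "AE x in M. \<psi> ((T ^^ n) x) \<noteq> \<psi> x"
      using \<psi>_range \<psi>_eq_null[of 1] AE_space
    proof eventually_elim
      case (elim x)
      define j where "j = nat \<lfloor>N * \<psi> x\<rfloor>"
      have "0 \<le> N * \<psi> x" "N * \<psi> x < N" using elim by (auto simp: N_def)
      then have "j < N" "real j \<le> N * \<psi> x" "N * \<psi> x \<le> real (Suc j)"
        unfolding j_def by linarith+
      then have "\<psi> x \<in> {real j / N .. real (Suc j) / N}" by (simp add: N_def field_simps)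
      with \<open>j < N\<close> elim show ?case by (auto simp: E_def W_def)
    qed
    with neg show False by simp
  qed
  then obtain j where j: "measure M (E j) \<noteq> 0" by blast
  have "measure M (E j) \<le> measure M {x \<in> space M. \<psi> x \<in> {real j / N .. real (Suc j) / N}}"
    by (intro finite_measure_mono) (auto simp: E_def W_def)
  also have "\<dots> \<le> real (Suc j) / N - real j / N"
    by (intro \<psi>_unif divide_right_mono) auto
  also have "\<dots> = 1 / N" by (simp add: add_divide_distrib)
  finally have small: "measure M (E j) \<le> 1 / N" .
  \<comment> \<open>Modulo null sets, membership in \<open>E j\<close> depends on the coordinate
    alone, and on \<open>W\<close> a point and its \<open>n\<close>-th iterate share it. Equality of
    measures gives the converse inclusion.\<close>
  have per: "AE x in M. x \<in> E j \<longleftrightarrow> (T ^^ n) x \<in> E j"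
  proof -
    obtain C where C: "AE x in M. x \<in> E j \<longleftrightarrow> \<psi> x \<in> C" using \<psi>_gen[OF E_meas] by blast
    have "AE x in M. x \<in> E j \<longrightarrow> x \<in> {x \<in> space M. (T ^^ n) x \<in> E j}"
      using C AE_funpow[OF C, of n]
      by eventually_elim (auto simp: E_def W_def)
    then have "AE x in M. x \<in> E j \<longleftrightarrow> x \<in> {x \<in> space M. (T ^^ n) x \<in> E j}"
      by (intro AE_iff_if_imp) (auto simp: measure_funpow)
    then show ?thesis using AE_space by eventually_elim auto
  qed
  define U where "U = {x \<in> space M. \<exists>i<n. (T ^^ i) x \<in> E j}"
  have [measurable]: "U \<in> sets M" unfolding U_def by measurable
  have "(AE x in M. x \<in> U) \<or> (AE x in M. x \<notin> U)"
  proof (rule erg_subset)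
    have "AE x in M. T x \<in> U \<longrightarrow> x \<in> U"
      using per AE_space
    proof eventually_elim
      case (elim x)
      show ?case
      proof
        assume "T x \<in> U"
        then obtain i where i: "i < n" "(T ^^ Suc i) x \<in> E j"
          by (auto simp: U_def funpow_swap1)
        show "x \<in> U"
        proof (cases "Suc i = n")
          case True
          with i elim n show ?thesis by (auto simp: U_def intro!: exI[of _ 0])
        next
          case False
          with i elim show ?thesis by (auto simp: U_def intro!: exI[of _ "Suc i"])
        qed
      qed
    qed
    then show "(AE x in M. x \<in> U \<longrightarrow> T x \<in> U) \<or> (AE x in M. T x \<in> U \<longrightarrow> x \<in> U)" ..
  qed measurable
  moreover have "measure M U < 1"
  proof -
    have "measure M U \<le> measure M (\<Union>i<n. {x \<in> space M. (T ^^ i) x \<in> E j})"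
      by (intro finite_measure_mono) (auto simp: U_def)
    also have "\<dots> \<le> (\<Sum>i<n. measure M {x \<in> space M. (T ^^ i) x \<in> E j})"
      by (intro finite_measure_subadditive_finite) auto
    also have "\<dots> = n * measure M (E j)" by (simp add: measure_funpow)
    also have "\<dots> \<le> n * (1 / N)" using small by (intro mult_left_mono) auto
    also have "\<dots> < 1" by (simp add: N_def)
    finally show ?thesis .
  qed
  moreover have "measure M (E j) \<le> measure M U"
    using n by (intro finite_measure_mono) (auto simp: U_def E_def W_def intro!: exI[of _ 0])
  ultimately show False
    using j prob_eq_1[of U] prob_eq_0[of U] measure_le_0_iff[of M "E j"] by auto
qed

end

section \<open>Cocycles, correlations and eigenfunctions\<close>

lemma borel_measurable_cnj [measurable]:
  "f \<in> borel_measurable M \<Longrightarrow> (\<lambda>x. cnj (f x)) \<in> borel_measurable M"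
  by (rule borel_measurable_continuous_on[where f=cnj]) (auto intro: continuous_intros)

lemma integral_norm_bound_AE:
  fixes f :: "'a \<Rightarrow> 'b::{banach, second_countable_topology}"
  assumes "integrable M f" "integrable M g" "AE x in M. norm (f x) \<le> g x"
  shows "norm (\<integral>x. f x \<partial>M) \<le> (\<integral>x. g x \<partial>M)"
  using assms by (intro order_trans[OF integral_norm_bound integral_mono_AE]) auto

context uniform_ergodic
begin

text \<open>This is \<open>c\<close> to the number of visits of \<open>T x, ..., (T ^^ n) x\<close>
  to \<open>B\<close>. The product form splits along orbits, telescopes in norm estimates and
  factorises under independent changes of \<open>B\<close>.\<close>

definition cocycle :: "complex \<Rightarrow> 'a set \<Rightarrow> nat \<Rightarrow> 'a \<Rightarrow> complex" where
  "cocycle c B n x = (\<Prod>i<n. if (T ^^ Suc i) x \<in> B then c else 1)"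

definition corr :: "complex \<Rightarrow> 'a set \<Rightarrow> 'a set \<Rightarrow> nat \<Rightarrow> complex" where
  "corr c B H n = (\<integral>x. indicator H x * indicator H ((T ^^ n) x) * cocycle c B n x \<partial>M)"

lemma cocycle_meas [measurable]:
  assumes [measurable]: "B \<in> sets M"
  shows "cocycle c B n \<in> borel_measurable M"
  unfolding cocycle_def by measurable

lemma norm_cocycle: "norm c = 1 \<Longrightarrow> norm (cocycle c B n x) = 1"
  unfolding cocycle_def by (auto simp: prod_norm[symmetric] intro!: prod.neutral)

lemma cocycle_add: "cocycle c B (k + n) x = cocycle c B k x * cocycle c B n ((T ^^ k) x)"
proof (induction n)
  case (Suc n)
  have "(T ^^ Suc (k + n)) x = (T ^^ Suc n) ((T ^^ k) x)"
    using funpow_add[of "Suc n" k T] by (simp add: add.commute)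
  then show ?case using Suc by (simp add: cocycle_def)
qed (simp add: cocycle_def)

text \<open>A product of factors of norm at most 1 changes by at most the sum of the changes of its
  factors, and factor \<open>i\<close> changes only where \<open>(T ^^ Suc i) x\<close> lies in the
  symmetric difference. This makes smallness of correlations stable under small changes of the
  set.\<close>

lemma norm_corr_diff_le:
  assumes c: "norm c = 1" and [measurable]: "B \<in> sets M" "C \<in> sets M" "H \<in> sets M"
  shows "norm (corr c B H n - corr c C H n) \<le> 2 * real n * measure M (sym_diff B C)"
proof -
  let ?h = "\<lambda>x. indicator H x * indicator H ((T ^^ n) x) :: complex"
  have int: "integrable M (\<lambda>x. ?h x * cocycle c B n x)" if [measurable]: "B \<in> sets M" for B
    by (rule integrable_const_bound[of _ 1])
      (auto simp: norm_mult norm_cocycle[OF c] indicator_def)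
  have mD [measurable]: "{x \<in> space M. (T ^^ Suc i) x \<in> sym_diff B C} \<in> sets M" for i
    by measurable
  have int_ind: "integrable M (indicator {x \<in> space M. (T ^^ Suc i) x \<in> sym_diff B C} :: 'a \<Rightarrow> real)" for i
    by (rule integrable_real_indicator[OF mD]) (simp add: emeasure_eq_measure)
  have "norm (corr c B H n - corr c C H n) =
      norm (\<integral>x. ?h x * cocycle c B n x - ?h x * cocycle c C n x \<partial>M)"
    unfolding corr_def by (subst Bochner_Integration.integral_diff) (auto intro!: int)
  also have "\<dots> \<le> (\<integral>x. norm (?h x * cocycle c B n x - ?h x * cocycle c C n x) \<partial>M)"
    by (rule integral_norm_bound)
  also have "\<dots> \<le> (\<integral>x. (\<Sum>i<n. 2 * indicator {x \<in> space M. (T ^^ Suc i) x \<in> sym_diff B C} x) \<partial>M)"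
  proof (rule integral_mono)
    show "integrable M (\<lambda>x. norm (?h x * cocycle c B n x - ?h x * cocycle c C n x))"
      by (intro integrable_norm Bochner_Integration.integrable_diff int) auto
    show "integrable M (\<lambda>x. \<Sum>i<n. 2 * indicator {x \<in> space M. (T ^^ Suc i) x \<in> sym_diff B C} x :: real)"
      by (intro Bochner_Integration.integrable_sum integrable_mult_right int_ind)
    fix x assume x: "x \<in> space M"
    have "norm (?h x * cocycle c B n x - ?h x * cocycle c C n x)
      \<le> norm (cocycle c B n x - cocycle c C n x)"
      by (auto simp: indicator_def)
    also have "\<dots> \<le> (\<Sum>i<n. norm ((if (T ^^ Suc i) x \<in> B then c else 1) -
        (if (T ^^ Suc i) x \<in> C then c else 1)))"
      unfolding cocycle_def by (rule norm_prod_diff) (auto simp: c)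
    also have "\<dots> \<le> (\<Sum>i<n. 2 * indicator {x \<in> space M. (T ^^ Suc i) x \<in> sym_diff B C} x)"
      using x norm_triangle_ineq4[of c 1] norm_triangle_ineq4[of 1 c] c
      by (intro sum_mono) (auto simp: indicator_def)
    finally show "norm (?h x * cocycle c B n x - ?h x * cocycle c C n x) \<le>
        (\<Sum>i<n. 2 * indicator {x \<in> space M. (T ^^ Suc i) x \<in> sym_diff B C} x)" .
  qed
  also have "\<dots> = (\<Sum>i<n. 2 * measure M {x \<in> space M. (T ^^ Suc i) x \<in> sym_diff B C})"
    using int_ind mD by (subst Bochner_Integration.integral_sum) (simp_all del: funpow.simps)
  also have "\<dots> = 2 * real n * measure M (sym_diff B C)"
    by (subst measure_funpow) auto
  finally show ?thesis by simp
qed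

lemma expectation_squared_le:
  fixes f :: "'a \<Rightarrow> real"
  assumes "integrable M f" "integrable M (\<lambda>x. (f x)\<^sup>2)"
  shows "(\<integral>x. f x \<partial>M)\<^sup>2 \<le> (\<integral>x. (f x)\<^sup>2 \<partial>M)"
  using variance_positive[of f] variance_eq[OF assms] by simp

lemma eigenfunction_funpow:
  assumes "AE x in M. g (T x) = (if T x \<in> B then c else 1) * g x"
  shows "AE x in M. g ((T ^^ k) x) = cocycle c B k x * g x"
proof (induction k)
  case (Suc k)
  from Suc AE_funpow[OF assms, of k] show ?case
    by eventually_elim (auto simp: cocycle_def)
qed (simp add: cocycle_def)

text \<open>
  All the functions \<open>v k = (1\<^sub>H \<circ> T\<^sup>k) \<cdot> cocycle k\<close> have the same integral against \<open>g\<close>, whereas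
  \<open>v L, v (2 L), \<dots>, v (J L)\<close> are almost orthogonal; so this integral is small.
\<close>

lemma eigenfunction_integral_le:
  fixes g :: "'a \<Rightarrow> complex"
  assumes c: "norm c = 1" and [measurable]: "B \<in> sets M" "H \<in> sets M" "g \<in> borel_measurable M"
    and bound: "AE x in M. norm (g x) \<le> r"
    and eig: "AE x in M. g (T x) = (if T x \<in> B then c else 1) * g x"
    and J: "J \<ge> 1"
    and corr: "\<And>n. n \<in> {L..L * J} \<Longrightarrow> norm (corr c B H n) \<le> 1 / real J"
  shows "(norm (\<integral>x. indicator H x * g x \<partial>M))\<^sup>2 \<le> 2 * r\<^sup>2 / J"
proof -
  define v where "v k x = indicator H ((T ^^ k) x) * cocycle c B k x" for k x
  have [measurable]: "v k \<in> borel_measurable M" for k unfolding v_def by measurable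
  have v_le: "norm (v k x) \<le> 1" for k x
    by (simp add: v_def norm_mult norm_cocycle[OF c] indicator_def)
  have r: "r \<ge> 0"
  proof -
    have "AE x in M. 0 \<le> r" using bound by eventually_elim (use norm_ge_zero order_trans in blast)
    then show ?thesis by simp
  qed
  have int_vg: "integrable M (\<lambda>x. v k x * g x)" for k
  proof (rule integrable_const_bound[of _ r])
    show "AE x in M. norm (v k x * g x) \<le> r"
      using bound
      by eventually_elim (use mult_mono[OF v_le[of k]] in \<open>fastforce simp: norm_mult\<close>)
  qed measurable
  let ?a = "\<integral>x. indicator H x * g x \<partial>M"
  \<comment> \<open>Invariance of the measure shifts the integrand by \<open>T ^^ k\<close>; the
    eigenvalue equation then turns \<open>g\<close> at the shifted point into the cocycle times
    \<open>g x\<close>.\<close>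
  have a: "(\<integral>x. v k x * g x \<partial>M) = ?a" for k
  proof -
    have "?a = (\<integral>x. indicator H ((T ^^ k) x) * g ((T ^^ k) x) \<partial>M)"
      by (rule integral_funpow[symmetric]) measurable
    also have "\<dots> = (\<integral>x. v k x * g x \<partial>M)"
      by (rule integral_cong_AE) (use eigenfunction_funpow[OF eig, of k] in \<open>auto simp: v_def\<close>)
    finally show ?thesis ..
  qed
  have int_vv: "integrable M (\<lambda>x. v k x * cnj (v l x))" for k l
    using mult_mono[OF v_le[of k] v_le[of l]]
    by (intro integrable_const_bound[of _ 1]) (auto simp: norm_mult)
  \<comment> \<open>The cocycle up to time \<open>l\<close> is the one up to \<open>k\<close> times
    a shifted one; the common unimodular factor cancels against its conjugate, and only the time
    difference remains.\<close>
  have less: "(\<integral>x. v l x * cnj (v k x) \<partial>M) = corr c B H (l - k)" if "k \<le> l" for k l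
  proof -
    have "corr c B H (l - k) = (\<integral>x. indicator H ((T ^^ k) x) * indicator H ((T ^^ (l - k)) ((T ^^ k) x))
        * cocycle c B (l - k) ((T ^^ k) x) \<partial>M)"
      unfolding corr_def by (rule integral_funpow[symmetric]) measurable
    also have "\<dots> = (\<integral>x. v l x * cnj (v k x) \<partial>M)"
    proof (rule Bochner_Integration.integral_cong)
      fix x
      have *: "(T ^^ (l - k)) ((T ^^ k) x) = (T ^^ l) x"
        using funpow_add[of "l - k" k T] that by simp
      have "cocycle c B l x = cocycle c B k x * cocycle c B (l - k) ((T ^^ k) x)"
        using cocycle_add[of c B k "l - k" x] that by simp
      moreover have "cocycle c B k x * cnj (cocycle c B k x) = 1"
        using norm_cocycle[OF c, of B k x] by (simp add: complex_norm_square[symmetric])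
      ultimately show "indicator H ((T ^^ k) x) * indicator H ((T ^^ (l - k)) ((T ^^ k) x))
        * cocycle c B (l - k) ((T ^^ k) x) = v l x * cnj (v k x)"
        unfolding v_def * by (simp add: indicator_def)
    qed simp
    finally show ?thesis ..
  qed
  \<comment> \<open>Distinct multiples of \<open>L\<close> up to \<open>J * L\<close> differ by a
    time between \<open>L\<close> and \<open>L * J\<close>, which is exactly the window in which
    \<open>corr\<close> is assumed small.\<close>
  have vv: "norm (\<integral>x. v (i * L) x * cnj (v (j * L) x) \<partial>M) \<le> 1 / J"
    if ij: "i \<noteq> j" "i \<in> {1..J}" "j \<in> {1..J}" for i j
  proof -
    have *: "norm (\<integral>x. v (i * L) x * cnj (v (j * L) x) \<partial>M) \<le> 1 / J"
      if "j < i" "i \<le> J" for i j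
    proof -
      have "1 * L \<le> (i - j) * L" "(i - j) * L \<le> J * L" using that by (intro mult_right_mono; simp)+
      moreover have "i * L - j * L = (i - j) * L" by (simp add: diff_mult_distrib)
      ultimately have "i * L - j * L \<in> {L..L * J}" by (metis atLeastAtMost_iff mult.commute mult_1)
      then show ?thesis using less[of "j * L" "i * L"] corr that by simp
    qed
    show ?thesis
    proof (cases "j < i")
      case False
      have "(\<integral>x. v (i * L) x * cnj (v (j * L) x) \<partial>M) = cnj (\<integral>x. v (j * L) x * cnj (v (i * L) x) \<partial>M)"
        by (subst Bochner_Integration.integral_cnj[symmetric]) (simp add: mult.commute del: Bochner_Integration.integral_cnj)
      then show ?thesis using *[of i j] False ij by (simp del: Bochner_Integration.integral_cnj)
    qed (use * ij in auto)
  qed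
  have vv1: "norm (\<integral>x. v k x * cnj (v l x) \<partial>M) \<le> 1" for k l
  proof -
    have "norm (\<integral>x. v k x * cnj (v l x) \<partial>M) \<le> (\<integral>x. 1 \<partial>M)"
      using mult_mono[OF v_le[of k] v_le[of l]] by (intro integral_norm_bound_AE int_vv) (auto simp: norm_mult)
    then show ?thesis by (simp add: prob_space)
  qed
  define u where "u x = (\<Sum>i\<in>{1..J}. v (i * L) x)" for x
  have [measurable]: "u \<in> borel_measurable M" unfolding u_def by measurable
  have u_le: "norm (u x) \<le> J" for x
    unfolding u_def using sum_norm_bound[of "{1..J}" "\<lambda>i. v (i * L) x" 1] v_le by simp
  have int_u: "integrable M (\<lambda>x. norm (u x))"
    by (rule integrable_const_bound[of _ J]) (auto simp: u_le)
  have int_u2: "integrable M (\<lambda>x. (norm (u x))\<^sup>2)"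
    by (rule integrable_const_bound[of _ "J\<^sup>2"]) (auto simp: u_le power_mono)
  have u2: "(\<integral>x. (norm (u x))\<^sup>2 \<partial>M) \<le> 2 * J"
  proof -
    have "complex_of_real (\<integral>x. (norm (u x))\<^sup>2 \<partial>M) = (\<integral>x. complex_of_real ((norm (u x))\<^sup>2) \<partial>M)"
      by (rule integral_complex_of_real[symmetric])
    also have "\<dots> = (\<integral>x. (\<Sum>i\<in>{1..J}. \<Sum>j\<in>{1..J}. v (i * L) x * cnj (v (j * L) x)) \<partial>M)"
      by (simp only: complex_norm_square u_def cnj_sum sum_product)
    also have "\<dots> = (\<Sum>i\<in>{1..J}. \<Sum>j\<in>{1..J}. \<integral>x. v (i * L) x * cnj (v (j * L) x) \<partial>M)"
      by (simp add: Bochner_Integration.integral_sum int_vv)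
    finally have "(\<integral>x. (norm (u x))\<^sup>2 \<partial>M) = norm (\<Sum>i\<in>{1..J}. \<Sum>j\<in>{1..J}. \<integral>x. v (i * L) x * cnj (v (j * L) x) \<partial>M)"
      by (smt (verit) Bochner_Integration.integral_nonneg norm_of_real zero_le_power2)
    \<comment> \<open>Each of the \<open>J * J\<close> terms is allowed \<open>1 / J\<close> and
      each diagonal one 1 in addition, which makes \<open>2 * J\<close> in total.\<close>
    also have "\<dots> \<le> (\<Sum>i\<in>{1..J}. \<Sum>j\<in>{1..J}. (if i = j then 1 else 0) + 1 / J)"
    proof (intro sum_norm_le)
      fix i j assume ij: "i \<in> {1..J}" "j \<in> {1..J}"
      show "norm (\<integral>x. v (i * L) x * cnj (v (j * L) x) \<partial>M) \<le> (if i = j then 1 else 0) + 1 / J"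
      proof (cases "i = j")
        case True
        have "(0::real) \<le> 1 / J" by simp
        then show ?thesis using vv1[of "i * L" "j * L"] True by (smt (verit))
      qed (use vv[OF _ ij] in simp)
    qed
    also have "\<dots> = 2 * J" using J by (simp add: sum.distrib)
    finally show ?thesis .
  qed
  have "of_nat J * ?a = (\<integral>x. u x * g x \<partial>M)"
    unfolding u_def sum_distrib_right by (simp add: Bochner_Integration.integral_sum int_vg a)
  then have "J * norm ?a = norm (\<integral>x. u x * g x \<partial>M)"
    by (metis norm_mult norm_of_nat)
  also have "\<dots> \<le> (\<integral>x. r * norm (u x) \<partial>M)"
  proof (rule integral_norm_bound_AE)
    show "integrable M (\<lambda>x. u x * g x)"
      unfolding u_def sum_distrib_right by (intro Bochner_Integration.integrable_sum int_vg)
    show "integrable M (\<lambda>x. r * norm (u x))" using int_u by simp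
    show "AE x in M. norm (u x * g x) \<le> r * norm (u x)"
      using bound by eventually_elim (auto simp: norm_mult mult.commute[of "norm (u _)"] intro: mult_right_mono)
  qed
  also have "\<dots> = r * (\<integral>x. norm (u x) \<partial>M)" by simp
  finally have "(J * norm ?a)\<^sup>2 \<le> (r * (\<integral>x. norm (u x) \<partial>M))\<^sup>2"
    by (intro power_mono) auto
  also have "\<dots> = r\<^sup>2 * (\<integral>x. norm (u x) \<partial>M)\<^sup>2" by (simp add: power_mult_distrib)
  also have "\<dots> \<le> r\<^sup>2 * (2 * J)"
    using expectation_squared_le[OF int_u int_u2] u2 by (intro mult_left_mono) auto
  finally show ?thesis using J by (simp add: power_mult_distrib power2_eq_square field_simps)
qed

end

section \<open>Eigenfunctions of induced maps\<close>

lemma return_time_1: "T x \<in> A \<Longrightarrow> return_time T A x = 1"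
  unfolding return_time_def by (rule Least_equality) auto

text \<open>The witness \<open>n\<close> makes both \<open>LEAST\<close> terms genuine minima: as
  \<open>T x\<close> is outside \<open>A\<close>, it is at least 2 and also provides a return of
  \<open>T x\<close>.\<close>

lemma return_time_Suc:
  assumes "T x \<notin> A" "n \<ge> 1" "(T ^^ n) x \<in> A"
  shows "return_time T A x = Suc (return_time T A (T x))"
proof -
  have "return_time T A x = Suc (LEAST m. 1 \<le> Suc m \<and> (T ^^ Suc m) x \<in> A)"
    unfolding return_time_def by (rule Least_Suc) (use assms in auto)
  also have "(\<lambda>m. 1 \<le> Suc m \<and> (T ^^ Suc m) x \<in> A) = (\<lambda>m. 1 \<le> m \<and> (T ^^ m) (T x) \<in> A)"
  proof
    fix m show "(1 \<le> Suc m \<and> (T ^^ Suc m) x \<in> A) = (1 \<le> m \<and> (T ^^ m) (T x) \<in> A)"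
      using assms(1) by (cases m) (auto simp: funpow_swap1)
  qed
  finally show ?thesis unfolding return_time_def .
qed

lemma induced_1: "T x \<in> A \<Longrightarrow> induced T A x = T x"
  by (simp add: induced_def return_time_1)

text \<open>The point \<open>x\<close> may lie outside \<open>A\<close>: on the whole space
  \<open>induced T A\<close> is the map to the next entry point into \<open>A\<close>, and this
  point stays the same until the orbit reaches it.\<close>

lemma induced_Suc:
  assumes "T x \<notin> A" "n \<ge> 1" "(T ^^ n) x \<in> A"
  shows "induced T A x = induced T A (T x)"
  using return_time_Suc[OF assms] by (simp add: induced_def funpow_swap1)

lemma induced_in:
  assumes "n \<ge> 1" "(T ^^ n) x \<in> A"
  shows "induced T A x \<in> A"
  using LeastI[of "\<lambda>n. 1 \<le> n \<and> (T ^^ n) x \<in> A" n] assms by (simp add: induced_def return_time_def)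

section \<open>The normalized restriction of the measure\<close>

lemma AE_scale_measure_iff:
  assumes "r \<noteq> 0"
  shows "(AE x in scale_measure r M. P x) \<longleftrightarrow> (AE x in M. P x)"
proof -
  have "null_sets (scale_measure r M) = null_sets M"
    using assms by (auto simp: null_sets_def)
  then show ?thesis by (simp add: eventually_ae_filter space_scale_measure)
qed

context prob_space
begin

text \<open>In \<open>ennreal\<close> only infinity has inverse 0, and the measure is finite; for a
  null set the inverse is infinite.\<close>

lemma inverse_emeasure_neq_0: "inverse (emeasure M A) \<noteq> 0"
  by (simp add: emeasure_eq_measure)

lemma AE_normalized_on:
  assumes "A \<in> sets M"
  shows "(AE x in normalized_on M A. P x) \<longleftrightarrow> (AE x in M. x \<in> A \<longrightarrow> P x)"
  unfolding normalized_on_def using assms inverse_emeasure_neq_0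
  by (simp add: AE_scale_measure_iff AE_restrict_space_iff)

lemma prob_space_normalized_on:
  assumes "A \<in> sets M" "measure M A \<noteq> 0"
  shows "prob_space (normalized_on M A)"
proof
  have "A \<subseteq> space M" using assms sets.sets_into_space by blast
  then have "emeasure (normalized_on M A) (space (normalized_on M A)) = inverse (emeasure M A) * emeasure M A"
    using assms by (simp add: normalized_on_def space_scale_measure space_restrict_space Int_absorb1 emeasure_restrict_space)
  also have "\<dots> = 1"
    using assms by (simp add: emeasure_eq_measure inverse_ennreal ennreal_mult[symmetric] zero_less_measure_iff)
  finally show "emeasure (normalized_on M A) (space (normalized_on M A)) = 1" .
qed

lemma normalized_on_meas_iff:
  fixes f :: "'a \<Rightarrow> 'b::real_normed_vector"
  assumes "A \<in> sets M"
  shows "f \<in> borel_measurable (normalized_on M A) \<longleftrightarrow> (\<lambda>x. indicator A x *\<^sub>R f x) \<in> borel_measurable M"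
proof -
  have "borel_measurable (normalized_on M A) = (borel_measurable (restrict_space M A) :: ('a \<Rightarrow> 'b) set)"
    by (rule measurable_cong_sets) (simp_all add: normalized_on_def)
  then show ?thesis using assms by (simp add: borel_measurable_restrict_space_iff)
qed

end

section \<open>Decorrelation excludes eigenvalues of the induced map\<close>

context uniform_ergodic
begin

text \<open>A countable family of conditions: \<open>q\<close> selects the test set,
  \<open>m\<close> the distance of \<open>c\<close> from 1, \<open>J\<close> the accuracy. The
  window contains all differences of the multiples of \<open>L\<close> up to
  \<open>Suc J * L\<close>. With one \<open>L\<close> for all \<open>c\<close> it is finite, so a
  small change of \<open>B\<close> alters all correlations concerned by little.\<close>

definition decorrelated :: "real \<Rightarrow> nat \<Rightarrow> nat \<Rightarrow> 'a set \<Rightarrow> bool" where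
  "decorrelated q m J B \<longleftrightarrow>
     (\<exists>L. \<forall>c n. norm c = 1 \<and> norm (c - 1) \<ge> 1 / Suc m \<and> n \<in> {L..L * Suc J} \<longrightarrow>
        norm (corr c B {x \<in> space M. \<psi> x \<le> q} n) \<le> 1 / Suc J)"

text \<open>Fix \<open>m\<close> with \<open>1 / Suc m\<close> below the distance of
  \<open>c\<close> from 1 and let \<open>J\<close> tend to infinity: the bound
  \<open>2 * r\<^sup>2 / Suc J\<close> does not involve \<open>L\<close>, so the integral of
  \<open>g\<close> over each rational half-line of the coordinate vanishes.\<close>

lemma no_eigenfunction:
  fixes g :: "'a \<Rightarrow> complex"
  assumes [measurable]: "B \<in> sets M" "g \<in> borel_measurable M"
    and B: "\<And>q m J. q \<in> \<rat> \<Longrightarrow> decorrelated q m J B"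
    and c: "norm c = 1" "c \<noteq> 1"
    and bound: "AE x in M. norm (g x) \<le> r"
    and eig: "AE x in M. g (T x) = (if T x \<in> B then c else 1) * g x"
  shows "AE x in M. g x = 0"
proof (rule AE_zero_if_integral_zero)
  show "integrable M g" by (rule integrable_const_bound[OF bound]) fact
  fix q :: real assume q: "q \<in> \<rat>"
  obtain m where m: "1 / real (Suc m) < norm (c - 1)"
    using reals_Archimedean[of "norm (c - 1)"] c by (auto simp: inverse_eq_divide)
  let ?a = "\<integral>x. indicator {x \<in> space M. \<psi> x \<le> q} x * g x \<partial>M"
  have "(norm ?a)\<^sup>2 \<le> 2 * r\<^sup>2 / Suc J" for J
  proof -
    obtain L where L: "\<And>c n. norm c = 1 \<Longrightarrow> norm (c - 1) \<ge> 1 / Suc m \<Longrightarrow> n \<in> {L..L * Suc J} \<Longrightarrow>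
        norm (corr c B {x \<in> space M. \<psi> x \<le> q} n) \<le> 1 / Suc J"
      using B[OF q, of m J] unfolding decorrelated_def by blast
    show ?thesis
      by (rule eigenfunction_integral_le[OF c(1) _ _ _ bound eig _ L[OF c(1) less_imp_le[OF m]]])
        (simp_all, measurable)
  qed
  moreover have "(\<lambda>J. 2 * r\<^sup>2 / real (Suc J)) \<longlonglongrightarrow> 0"
    by (rule LIMSEQ_Suc[OF lim_const_over_n])
  ultimately have "(norm ?a)\<^sup>2 \<le> 0"
    by (intro LIMSEQ_le_const) auto
  then have "?a = 0" by simp
  also have "?a = (\<integral>x. indicator {x. \<psi> x \<le> q} x *\<^sub>R g x \<partial>M)"
    by (rule Bochner_Integration.integral_cong) (auto simp: indicator_def)
  finally show "(\<integral>x. indicator {x. \<psi> x \<le> q} x *\<^sub>R g x \<partial>M) = 0" .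
qed

lemma AE_if_AE_T:
  assumes [measurable]: "Measurable.pred M P" and "AE x in M. P (T x)"
  shows "AE x in M. P x"
proof -
  have "AE x in distr M M T. P x" using assms by (subst AE_distr_iff) auto
  then show ?thesis by (simp only: distr_T)
qed

text \<open>The set of points that never enter \<open>B\<close> at a positive time is mapped into
  itself, hence null or conull; were it conull, the preimage of \<open>B\<close> and so
  \<open>B\<close> itself would be null.\<close>

lemma AE_returns:
  assumes [measurable]: "B \<in> sets M" and B: "measure M B \<noteq> 0"
  shows "AE x in M. \<exists>n\<ge>1. (T ^^ n) x \<in> B"
proof -
  define N where "N = {x \<in> space M. \<forall>n\<ge>1. (T ^^ n) x \<notin> B}"
  have [measurable]: "N \<in> sets M" unfolding N_def by measurable
  have "AE x in M. x \<in> N \<longrightarrow> T x \<in> N"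
  proof (rule AE_I2, rule impI)
    fix x assume "x \<in> space M" and x: "x \<in> N"
    have "(T ^^ n) (T x) \<notin> B" for n
      using x[unfolded N_def] by (auto simp: funpow_swap1 dest: spec[of _ "Suc n"])
    then show "T x \<in> N" using x measurable_space[OF T_meas, of x] by (auto simp: N_def)
  qed
  then have "(AE x in M. x \<in> N) \<or> (AE x in M. x \<notin> N)" by (intro erg_subset) auto
  then show ?thesis
  proof
    assume "AE x in M. x \<in> N"
    then have "AE x in M. T x \<notin> B" by eventually_elim (auto simp: N_def dest: spec[of _ 1])
    then have "AE x in M. x \<notin> B" by (rule AE_if_AE_T[of "\<lambda>x. x \<notin> B", rotated]) measurable
    then have "measure M B = 0" by (simp add: prob_eq_0)
    with B show ?thesis by simp
  next
    assume "AE x in M. x \<notin> N"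
    then show ?thesis using AE_space by eventually_elim (auto simp: N_def)
  qed
qed

lemma return_time_meas [measurable]:
  assumes [measurable]: "B \<in> sets M"
  shows "return_time T B \<in> M \<rightarrow>\<^sub>M count_space UNIV"
  unfolding return_time_def[abs_def] by measurable

lemma induced_meas [measurable]:
  assumes [measurable]: "B \<in> sets M"
  shows "induced T B \<in> M \<rightarrow>\<^sub>M M"
  unfolding induced_def[abs_def]
  by (rule measurable_compose_countable[OF _ return_time_meas]) auto

text \<open>If \<open>B\<close> were null, the constant function 1 would solve the eigenvalue
  equation for every \<open>c\<close>, for instance for \<open>- 1\<close>, against
  \<open>no_eigenfunction\<close>.\<close>

lemma measure_pos_if_decorrelated:
  assumes [measurable]: "B \<in> sets M"
    and B: "\<And>q m J. q \<in> \<rat> \<Longrightarrow> decorrelated q m J B"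
  shows "measure M B \<noteq> 0"
proof
  assume "measure M B = 0"
  then have "AE x in M. x \<notin> B" by (simp add: prob_eq_0)
  then have "AE x in M. T x \<notin> B" using AE_funpow[of _ 1] by simp
  then have "AE x in M. (1::complex) = 0"
    by (intro no_eigenfunction[OF assms(1) _ B, of "\<lambda>_. 1" "- 1" 1]) auto
  then show False by simp
qed

text \<open>
  An eigenfunction \<open>f\<close> of the induced map extends to the whole space as
  \<open>g x = f (induced T B x)\<close>, which turns the eigenvalue equation into a cohomological equation
  for \<open>T\<close> itself.
\<close>

lemma weakly_mixing_induced:
  assumes B_meas [measurable]: "B \<in> sets M"
    and B: "\<And>q m J. q \<in> \<rat> \<Longrightarrow> decorrelated q m J B"
  shows "weakly_mixing (normalized_on M B) (induced T B)"
  unfolding weakly_mixing_def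
proof (rule notI, elim exE conjE)
  fix f :: "'a \<Rightarrow> complex" and c
  assume f: "f \<in> borel_measurable (normalized_on M B)"
    and f0: "\<not> (AE x in normalized_on M B. f x = 0)"
    and int_f: "(\<integral>x. f x \<partial>normalized_on M B) = 0"
    and eig: "AE x in normalized_on M B. f (induced T B x) = c * f x"
  have pos: "measure M B \<noteq> 0" using measure_pos_if_decorrelated[OF assms] .
  interpret N: prob_space "normalized_on M B" by (rule prob_space_normalized_on[OF B_meas pos])
  \<comment> \<open>Extension by 0 gives a function measurable on the whole space that can be
    composed with \<open>induced T B\<close>.\<close>
  define f' where "f' x = indicator B x *\<^sub>R f x" for x
  have [measurable]: "f' \<in> borel_measurable M"
    using f unfolding f'_def by (simp add: normalized_on_meas_iff)
  define g where "g x = f' (induced T B x)" for x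
  have g_meas [measurable]: "g \<in> borel_measurable M" unfolding g_def by measurable
  \<comment> \<open>Where \<open>T x\<close> lies in \<open>B\<close> it is the next entry point, so
    \<open>g x\<close> is the value of \<open>f\<close> at \<open>T x\<close>; invariance of the
    measure carries the statement from \<open>T x\<close> back to \<open>x\<close>.\<close>
  have f_const: "AE x in M. x \<in> B \<longrightarrow> f x = k" if "AE x in M. g x = k" for k
  proof -
    from that have "AE x in M. T x \<in> B \<longrightarrow> f' (T x) = k"
      by eventually_elim (auto simp: g_def induced_1)
    then have "AE x in M. x \<in> B \<longrightarrow> f' x = k"
      by (rule AE_if_AE_T[of "\<lambda>x. x \<in> B \<longrightarrow> f' x = k", rotated]) measurable
    then show ?thesis by eventually_elim (auto simp: f'_def)
  qed
  have ret: "AE x in M. \<exists>n\<ge>1. (T ^^ n) x \<in> B" using AE_returns[OF _ pos] by simp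
  have g_eig: "AE x in M. g (T x) = (if T x \<in> B then c else 1) * g x"
  proof -
    have "AE x in M. x \<in> B \<longrightarrow> f (induced T B x) = c * f x"
      using eig by (simp add: AE_normalized_on)
    from AE_funpow[OF this, of 1] have "AE x in M. T x \<in> B \<longrightarrow> f (induced T B (T x)) = c * f (T x)"
      by simp
    moreover have "AE x in M. \<exists>n\<ge>1. (T ^^ n) (T x) \<in> B" using AE_funpow[OF ret, of 1] by simp
    ultimately show ?thesis using ret
    proof eventually_elim
      case (elim x)
      show ?case
      proof (cases "T x \<in> B")
        case True
        obtain n where "n \<ge> 1" "(T ^^ n) (T x) \<in> B" using elim(2) by blast
        then have "induced T B (T x) \<in> B" by (rule induced_in)
        then show ?thesis using elim(1) True by (simp add: g_def f'_def induced_1)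
      next
        case False
        obtain n where "n \<ge> 1" "(T ^^ n) x \<in> B" using elim(3) by blast
        then have "induced T B x = induced T B (T x)" by (rule induced_Suc[of T, OF False])
        with False show ?thesis by (simp add: g_def)
      qed
    qed
  qed
  \<comment> \<open>One step along the orbit multiplies the norm of \<open>g\<close> by 1 or by
    \<open>norm c\<close>; on whichever side of 1 the latter lies, the norm is monotone along
    orbits.\<close>
  obtain r where r: "AE x in M. norm (g x) = r"
  proof -
    have "(AE x in M. norm (g x) \<le> norm (g (T x))) \<or> (AE x in M. norm (g (T x)) \<le> norm (g x))"
    proof (cases "norm c \<le> 1")
      case True
      from g_eig have "AE x in M. norm (g (T x)) \<le> norm (g x)"
        by eventually_elim (auto simp: norm_mult True mult_left_le_one_le)
      then show ?thesis ..
    next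
      case False
      then have *: "1 * norm z \<le> norm c * norm z" for z :: complex by (intro mult_right_mono) auto
      from g_eig have "AE x in M. norm (g x) \<le> norm (g (T x))"
        by eventually_elim (use * in \<open>auto simp: norm_mult\<close>)
      then show ?thesis ..
    qed
    then have "\<exists>r. AE x in M. norm (g x) = r" by (intro erg_const) auto
    then show ?thesis using that by blast
  qed
  have g0: "\<not> (AE x in M. g x = 0)"
    using f_const[of 0] f0 by (auto simp: AE_normalized_on)
  \<comment> \<open>The norm of \<open>g\<close> is a nonzero constant, so for \<open>norm c\<close>
    other than 1 almost no orbit could ever enter \<open>B\<close>.\<close>
  have c1: "norm c = 1"
  proof (rule ccontr)
    assume nc: "norm c \<noteq> 1"
    have r0: "r \<noteq> 0" using g0 r by auto
    have "AE x in M. norm (g (T x)) = r" using AE_funpow[OF r, of 1] by simp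
    then have "AE x in M. T x \<notin> B"
      using r g_eig by eventually_elim (use nc r0 in \<open>auto simp: norm_mult split: if_splits\<close>)
    then have "AE x in M. x \<notin> B" by (rule AE_if_AE_T[of "\<lambda>x. x \<notin> B", rotated]) measurable
    with pos show False by (simp add: prob_eq_0)
  qed
  show False
  proof (cases "c = 1")
    \<comment> \<open>Decorrelation says nothing about \<open>c = 1\<close>. Here \<open>g\<close>
      is invariant, so \<open>f\<close> is constant on \<open>B\<close> by ergodicity, and its mean
      0 makes it vanish.\<close>
    case True
    have inv: "AE x in M. g (T x) = g x" using g_eig by (simp add: True cong: if_cong)
    then have "AE x in M. Re (g x) \<le> Re (g (T x))" "AE x in M. Im (g x) \<le> Im (g (T x))"
      by (eventually_elim, simp)+
    then obtain a b where "AE x in M. Re (g x) = a" "AE x in M. Im (g x) = b"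
      using erg_const[of "\<lambda>x. Re (g x)"] erg_const[of "\<lambda>x. Im (g x)"] by auto
    then have "AE x in M. g x = Complex a b" by eventually_elim (simp add: complex_eq_iff)
    then have k: "AE x in normalized_on M B. f x = Complex a b"
      using f_const by (simp add: AE_normalized_on)
    then have "(\<integral>x. f x \<partial>normalized_on M B) = (\<integral>x. Complex a b \<partial>normalized_on M B)"
      using f by (intro integral_cong_AE) auto
    then have "Complex a b = 0" using int_f by (simp add: N.prob_space)
    with k f0 show False by simp
  next
    case False
    have "AE x in M. norm (g x) \<le> r" using r by eventually_elim simp
    then have "AE x in M. g x = 0"
      using no_eigenfunction[OF B_meas g_meas B c1 False] g_eig by blast
    with g0 show False by simp
  qed
qed

end

section \<open>Random unions of small pieces\<close>

text \<open>The probability that independent choices, each made with probability \<open>e\<close>,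
  select exactly the subset \<open>S\<close> of \<open>I\<close>. All means are finite sums over
  \<open>Pow I\<close>, which avoids a second probability space.\<close>

definition bernoulli_weight :: "real \<Rightarrow> 'i set \<Rightarrow> 'i set \<Rightarrow> real" where
  "bernoulli_weight e I S = e ^ card S * (1 - e) ^ card (I - S)"

text \<open>Independence in algebraic form: the mean of a product of factors governed by distinct
  indices is the product of the means. It is the expansion of a product of binomials over
  \<open>I\<close>.\<close>

lemma sum_bernoulli_weight_prod:
  fixes a b :: "'j \<Rightarrow> 'b::real_normed_field"
  assumes "finite I" "finite J" "inj_on p J" "p ` J \<subseteq> I"
  shows "(\<Sum>S\<in>Pow I. of_real (bernoulli_weight e I S) * (\<Prod>t\<in>J. if p t \<in> S then a t else b t)) =
    (\<Prod>t\<in>J. of_real e * a t + of_real (1 - e) * b t)"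
proof -
  \<comment> \<open>Indices not hit by \<open>p\<close> get the value 1 in both alternatives and
    contribute \<open>e + (1 - e) = 1\<close>.\<close>
  define ext where "ext f i = (if i \<in> p ` J then f (inv_into J p i) else 1)" for f :: "'j \<Rightarrow> 'b" and i
  have ext: "ext f (p t) = f t" if "t \<in> J" for f t
    using that assms(3) by (simp add: ext_def)
  have reindex: "(\<Prod>t\<in>J. g (p t)) = (\<Prod>i\<in>I. g i)" if "\<And>i. i \<in> I - p ` J \<Longrightarrow> g i = 1" for g :: "_ \<Rightarrow> 'b"
  proof -
    have "(\<Prod>t\<in>J. g (p t)) = (\<Prod>i\<in>p ` J. g i)" using assms(3) by (simp add: prod.reindex)
    also have "\<dots> = (\<Prod>i\<in>I. g i)" using assms that by (intro prod.mono_neutral_left) auto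
    finally show ?thesis .
  qed
  have "(\<Prod>t\<in>J. of_real e * a t + of_real (1 - e) * b t) =
      (\<Prod>t\<in>J. of_real e * ext a (p t) + of_real (1 - e) * ext b (p t))"
    by (intro prod.cong) (simp_all add: ext)
  also have "\<dots> = (\<Prod>i\<in>I. of_real e * ext a i + of_real (1 - e) * ext b i)"
    by (rule reindex) (simp add: ext_def)
  also have "\<dots> = (\<Sum>S\<in>Pow I. (\<Prod>i\<in>S. of_real e * ext a i) * (\<Prod>i\<in>I - S. of_real (1 - e) * ext b i))"
    using assms(1) by (rule prod_add)
  also have "\<dots> = (\<Sum>S\<in>Pow I. of_real (bernoulli_weight e I S) * (\<Prod>t\<in>J. if p t \<in> S then a t else b t))"
  proof (rule sum.cong)
    fix S assume S: "S \<in> Pow I"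
    have "(\<Prod>t\<in>J. if p t \<in> S then a t else b t) = (\<Prod>t\<in>J. if p t \<in> S then ext a (p t) else ext b (p t))"
      by (intro prod.cong) (simp_all add: ext)
    also have "\<dots> = (\<Prod>i\<in>I. if i \<in> S then ext a i else ext b i)"
      by (rule reindex) (simp add: ext_def)
    also have "\<dots> = (\<Prod>i\<in>S. ext a i) * (\<Prod>i\<in>I - S. ext b i)"
      using S assms(1) prod.If_cases[of I "\<lambda>i. i \<in> S" "ext a" "ext b"]
      by (auto simp: Int_absorb1 Diff_eq Collect_neg_eq)
    finally show "(\<Prod>i\<in>S. of_real e * ext a i) * (\<Prod>i\<in>I - S. of_real (1 - e) * ext b i) =
        of_real (bernoulli_weight e I S) * (\<Prod>t\<in>J. if p t \<in> S then a t else b t)"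
      by (simp add: prod.distrib bernoulli_weight_def)
  qed simp
  finally show ?thesis ..
qed

lemma sum_bernoulli_weight: "finite I \<Longrightarrow> (\<Sum>S\<in>Pow I. bernoulli_weight e I S) = 1"
  using sum_bernoulli_weight_prod[of I "{}" id e "\<lambda>_. 1::real" "\<lambda>_. 1"] by simp

lemma sum_bernoulli_weight_mem:
  assumes "finite I" "i \<in> I"
  shows "(\<Sum>S\<in>Pow I. bernoulli_weight e I S * indicator S i) = e"
proof -
  have "(\<Sum>S\<in>Pow I. bernoulli_weight e I S * (if i \<in> S then 1 else 0)) = e"
    using sum_bernoulli_weight_prod[of I "{i}" id e "\<lambda>_. 1::real" "\<lambda>_. 0"] assms by simp
  then show ?thesis by (simp add: indicator_def of_bool_def)
qed

text \<open>For a random variable with values 1 and \<open>c\<close> this is the second moment 1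
  minus the variance. It is the source of the exponential decay, uniformly for \<open>c\<close> away
  from 1.\<close>

lemma norm_convex_comb_sq:
  assumes "norm (c::complex) = 1"
  shows "(norm (of_real e + of_real (1 - e) * c))\<^sup>2 = 1 - e * (1 - e) * (norm (c - 1))\<^sup>2"
proof -
  have "(Re c)\<^sup>2 + (Im c)\<^sup>2 = 1" using assms by (simp add: cmod_def)
  then have "(Im c)\<^sup>2 = 1 - (Re c)\<^sup>2" by simp
  then show ?thesis
    by (simp add: cmod_power2 power_mult_distrib) (simp add: power2_eq_square algebra_simps)
qed

lemma norm_cis_diff_le: "norm (cis a - cis b) \<le> \<bar>a - b\<bar>"
proof -
  have "cis a - cis b = cis b * (cis (a - b) - 1)"
    by (simp add: right_diff_distrib cis_mult)
  also have "norm \<dots> = 2 * \<bar>sin ((a - b) / 2)\<bar>"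
    by (simp only: norm_mult norm_cis cis_conv_exp dist_exp_i_1) simp
  also have "\<dots> \<le> \<bar>a - b\<bar>"
    using abs_sin_x_le_abs_x[of "(a - b) / 2"] by simp
  finally show ?thesis .
qed

lemma unit_circle_net:
  assumes "norm c = 1" "q \<ge> 1"
  shows "\<exists>k<q. norm (c - cis (2 * pi * real k / real q)) \<le> 2 * pi / q"
proof -
  define t where "t = Arg2pi c"
  have t: "0 \<le> t" "t < 2 * pi" "c = cis t"
    using Arg2pi[of c] assms(1) by (simp_all add: t_def cis_conv_exp is_Arg_def)
  define k where "k = nat \<lfloor>t * q / (2 * pi)\<rfloor>"
  have "0 \<le> t * q / (2 * pi)" "t * q / (2 * pi) < q"
    using t assms by (simp_all add: field_simps)
  then have k: "k < q" "real k \<le> t * q / (2 * pi)" "t * q / (2 * pi) \<le> real k + 1"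
    unfolding k_def by linarith+
  have "\<bar>t * q / (2 * pi) - k\<bar> * (2 * pi / q) \<le> 1 * (2 * pi / q)"
    using k by (intro mult_right_mono) auto
  also have "\<bar>t * q / (2 * pi) - k\<bar> * (2 * pi / q) = \<bar>(t * q / (2 * pi) - k) * (2 * pi / q)\<bar>"
    by (simp add: abs_mult)
  also have "(t * q / (2 * pi) - k) * (2 * pi / q) = t - 2 * pi * k / q"
    using assms by (simp add: field_simps)
  finally have "\<bar>t - 2 * pi * k / q\<bar> \<le> 2 * pi / q" by simp
  with k(1) t(3) norm_cis_diff_le[of t "2 * pi * k / q"] show ?thesis by auto
qed

section \<open>Small pieces and collisions along two orbit segments\<close>

context uniform_ergodic
begin

text \<open>The coordinate lies in \<open>{0..1}\<close> only almost everywhere; \<open>min\<close>,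
  and \<open>nat\<close> on negative values, keep the index in \<open>{..Suc m}\<close> at every
  point. Where the coordinate is in range, the cap changes nothing.\<close>

definition piece :: "nat \<Rightarrow> 'a \<Rightarrow> nat" where
  "piece m x = min (Suc m) (nat \<lfloor>real (Suc m) * \<psi> x\<rfloor>)"

lemma piece_meas [measurable]: "piece m \<in> M \<rightarrow>\<^sub>M count_space UNIV"
  unfolding piece_def[abs_def] by measurable

lemma piece_le: "piece m x \<in> {..Suc m}"
  by (simp add: piece_def)

lemma piece_neq:
  assumes "\<psi> x \<in> {0..1}" "\<psi> y \<in> {0..1}" "1 / Suc m < \<bar>\<psi> x - \<psi> y\<bar>"
  shows "piece m x \<noteq> piece m y"
proof
  assume eq: "piece m x = piece m y"
  have *: "piece m z = nat \<lfloor>real (Suc m) * \<psi> z\<rfloor>" if "\<psi> z \<in> {0..1}" for z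
  proof -
    have "real (Suc m) * \<psi> z \<le> real (Suc m) * 1" using that by (intro mult_left_mono) auto
    moreover have "\<lfloor>y\<rfloor> \<le> int (Suc m)" if "y \<le> real (Suc m)" for y using that by linarith
    ultimately have "\<lfloor>real (Suc m) * \<psi> z\<rfloor> \<le> int (Suc m)" by simp
    then show ?thesis by (simp add: piece_def)
  qed
  have nn: "0 \<le> real (Suc m) * \<psi> x" "0 \<le> real (Suc m) * \<psi> y" using assms by auto
  have "\<bar>real (Suc m) * \<psi> x - real (Suc m) * \<psi> y\<bar> < 1"
    using eq nn unfolding *[OF assms(1)] *[OF assms(2)] by linarith
  then have "real (Suc m) * \<bar>\<psi> x - \<psi> y\<bar> < 1"
    by (simp only: right_diff_distrib[symmetric] abs_mult)
  then show False using assms(3) by (simp add: field_simps)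
qed

text \<open>The sum type merges the segments of two independent starting points into one index
  family, as the second moment requires. \<open>Suc i\<close> matches the visits counted by
  \<open>cocycle\<close>.\<close>

definition orbit_pt :: "nat + nat \<Rightarrow> 'a \<times> 'a \<Rightarrow> 'a" where
  "orbit_pt s z = (case s of Inl i \<Rightarrow> (T ^^ Suc i) (fst z) | Inr i \<Rightarrow> (T ^^ Suc i) (snd z))"

lemma orbit_pt_meas [measurable]: "orbit_pt s \<in> M \<Otimes>\<^sub>M M \<rightarrow>\<^sub>M M"
  unfolding orbit_pt_def[abs_def] by (cases s) (auto simp del: funpow.simps)

definition orbit_idx :: "nat \<Rightarrow> (nat + nat) set" where
  "orbit_idx n = {..<n} <+> {..<n}"

lemma finite_orbit_idx [simp]: "finite (orbit_idx n)"
  by (simp add: orbit_idx_def)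

definition collide :: "nat \<Rightarrow> nat \<Rightarrow> ('a \<times> 'a) set" where
  "collide n m = {z \<in> space (M \<Otimes>\<^sub>M M). \<exists>s\<in>orbit_idx n. \<exists>t\<in>orbit_idx n - {s}. piece m (orbit_pt s z) = piece m (orbit_pt t z)}"

lemma collide_sets [measurable]: "collide n m \<in> sets (M \<Otimes>\<^sub>M M)"
proof -
  have [measurable]: "(\<lambda>z. piece m (orbit_pt s z)) \<in> M \<Otimes>\<^sub>M M \<rightarrow>\<^sub>M count_space UNIV" for s
    by (rule measurable_compose[OF orbit_pt_meas piece_meas])
  have "{z \<in> space (M \<Otimes>\<^sub>M M). real (piece m (orbit_pt s z)) = real (piece m (orbit_pt t z))}
      \<in> sets (M \<Otimes>\<^sub>M M)" for s t
    by (rule borel_measurable_eq; rule measurable_compose[of _ _ "count_space UNIV"]) simp_all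
  then have "{z \<in> space (M \<Otimes>\<^sub>M M). piece m (orbit_pt s z) = piece m (orbit_pt t z)}
      \<in> sets (M \<Otimes>\<^sub>M M)" for s t
    by simp
  note [measurable] = this
  have "collide n m = (\<Union>s\<in>orbit_idx n. \<Union>t\<in>orbit_idx n - {s}.
      {z \<in> space (M \<Otimes>\<^sub>M M). piece m (orbit_pt s z) = piece m (orbit_pt t z)})"
    by (auto simp: collide_def)
  also have "\<dots> \<in> sets (M \<Otimes>\<^sub>M M)"
    by (intro sets.finite_UN) simp_all
  finally show ?thesis .
qed

sublocale MM: pair_prob_space M M ..

text \<open>On one orbit this is aperiodicity applied at the earlier of the two points. On different
  orbits one point is fixed, and the coordinate of the other almost surely avoids the given
  value.\<close>

lemma AE_orbit_distinct:
  assumes "s \<noteq> t"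
  shows "AE z in M \<Otimes>\<^sub>M M. \<psi> (orbit_pt s z) \<noteq> \<psi> (orbit_pt t z)"
proof (rule MM.AE_pair_measure)
  show "{z \<in> space (M \<Otimes>\<^sub>M M). \<psi> (orbit_pt s z) \<noteq> \<psi> (orbit_pt t z)} \<in> sets (M \<Otimes>\<^sub>M M)"
    by measurable
  have same: "AE x in M. \<psi> ((T ^^ Suc i) x) \<noteq> \<psi> ((T ^^ Suc j) x)" if "i \<noteq> j" for i j
  proof -
    have *: "AE x in M. \<psi> ((T ^^ Suc j) x) \<noteq> \<psi> ((T ^^ Suc i) x)" if "i < j" for i j
    proof -
      have "(T ^^ Suc j) x = (T ^^ (j - i)) ((T ^^ Suc i) x)" for x
        using funpow_add[of "j - i" "Suc i" T] that by simp
      with AE_funpow[OF aperiodic[of "j - i"], of "Suc i"] that show ?thesis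
        by (simp del: funpow.simps)
    qed
    show ?thesis
    proof (cases "i < j")
      case True
      from *[OF True] show ?thesis by eventually_elim metis
    next
      case False
      with \<open>i \<noteq> j\<close> show ?thesis by (intro *) simp
    qed
  qed
  have const: "AE x in M. \<psi> ((T ^^ Suc i) x) \<noteq> c" for c i
    by (rule AE_funpow[OF \<psi>_eq_null])
  then have const': "AE x in M. c \<noteq> \<psi> ((T ^^ Suc i) x)" for c i
    by (simp only: eq_commute[of c])
  show "AE x in M. AE y in M. \<psi> (orbit_pt s (x, y)) \<noteq> \<psi> (orbit_pt t (x, y))"
  proof (cases s; cases t)
    fix i j assume ij: "s = Inl i" "t = Inl j"
    then have "AE x in M. \<psi> ((T ^^ Suc i) x) \<noteq> \<psi> ((T ^^ Suc j) x)" using same assms by auto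
    then show ?thesis by eventually_elim (simp add: ij orbit_pt_def del: funpow.simps)
  next
    fix i j assume ij: "s = Inr i" "t = Inr j"
    then have "AE x in M. \<psi> ((T ^^ Suc i) x) \<noteq> \<psi> ((T ^^ Suc j) x)" using same assms by auto
    then show ?thesis by (simp add: ij orbit_pt_def del: funpow.simps)
  qed (use const const' in \<open>auto simp: orbit_pt_def simp del: funpow.simps\<close>)
qed

text \<open>Almost surely the finitely many coordinates are distinct, so their gaps eventually
  exceed the mesh \<open>1 / Suc m\<close> and no two points share a piece; dominated convergence
  concludes.\<close>

lemma collide_tendsto_0: "(\<lambda>m. measure (M \<Otimes>\<^sub>M M) (collide n m)) \<longlonglongrightarrow> 0"
proof -
  have range: "AE z in M \<Otimes>\<^sub>M M. \<psi> (orbit_pt s z) \<in> {0..1}" for s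
  proof (rule MM.AE_pair_measure)
    show "{z \<in> space (M \<Otimes>\<^sub>M M). \<psi> (orbit_pt s z) \<in> {0..1}} \<in> sets (M \<Otimes>\<^sub>M M)"
      by measurable
    have *: "AE x in M. \<psi> ((T ^^ Suc i) x) \<in> {0..1}" for i by (rule AE_funpow[OF \<psi>_range])
    show "AE x in M. AE y in M. \<psi> (orbit_pt s (x, y)) \<in> {0..1}"
    proof (cases s)
      case (Inl i)
      from *[of i] show ?thesis by eventually_elim (simp add: Inl orbit_pt_def del: funpow.simps)
    next
      case (Inr i)
      with *[of i] show ?thesis by (simp add: Inr orbit_pt_def del: funpow.simps)
    qed
  qed
  have "AE z in M \<Otimes>\<^sub>M M. \<forall>s\<in>orbit_idx n. \<forall>t\<in>orbit_idx n. s \<noteq> t \<longrightarrow> \<psi> (orbit_pt s z) \<noteq> \<psi> (orbit_pt t z)"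
    by (intro AE_finite_allI) (use AE_orbit_distinct in \<open>auto elim!: AE_mp\<close>)
  moreover have "AE z in M \<Otimes>\<^sub>M M. \<forall>s\<in>orbit_idx n. \<psi> (orbit_pt s z) \<in> {0..1}"
    by (intro AE_finite_allI range) simp
  ultimately have ae: "AE z in M \<Otimes>\<^sub>M M. (\<lambda>m. indicator (collide n m) z :: real) \<longlonglongrightarrow> 0"
  proof eventually_elim
    case (elim z)
    have "\<forall>\<^sub>F m in sequentially. \<forall>s\<in>orbit_idx n. \<forall>t\<in>orbit_idx n. s \<noteq> t \<longrightarrow>
        piece m (orbit_pt s z) \<noteq> piece m (orbit_pt t z)"
    proof (intro eventually_ball_finite ballI finite_orbit_idx)
      fix s t assume st: "s \<in> orbit_idx n" "t \<in> orbit_idx n"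
      show "\<forall>\<^sub>F m in sequentially. s \<noteq> t \<longrightarrow> piece m (orbit_pt s z) \<noteq> piece m (orbit_pt t z)"
      proof (cases "s = t")
        case False
        have "(\<lambda>m. 1 / real (Suc m)) \<longlonglongrightarrow> 0" by (rule LIMSEQ_Suc[OF lim_const_over_n])
        then have "\<forall>\<^sub>F m in sequentially. 1 / real (Suc m) < \<bar>\<psi> (orbit_pt s z) - \<psi> (orbit_pt t z)\<bar>"
          by (rule order_tendstoD) (use elim st False in auto)
        then show ?thesis by eventually_elim (use elim st piece_neq in blast)
      qed simp
    qed
    then have "\<forall>\<^sub>F m in sequentially. (indicator (collide n m) z :: real) = 0"
      by eventually_elim (force simp: collide_def indicator_def)
    then show ?case by (rule tendsto_eventually)
  qed
  have "(\<lambda>m. \<integral>z. indicator (collide n m) z \<partial>(M \<Otimes>\<^sub>M M)) \<longlonglongrightarrow> (\<integral>z. (0::real) \<partial>(M \<Otimes>\<^sub>M M))"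
    by (rule integral_dominated_convergence[where w="\<lambda>_. 1"])
      (use ae in \<open>auto simp: indicator_def\<close>)
  then show ?thesis by simp
qed

section \<open>Random changes of a set and the second moment of correlations\<close>

definition perturb :: "'a set \<Rightarrow> nat \<Rightarrow> nat set \<Rightarrow> 'a set" where
  "perturb A m S = sym_diff A {x \<in> space M. piece m x \<in> S}"

lemma perturb_sets [measurable]: "A \<in> sets M \<Longrightarrow> perturb A m S \<in> sets M"
proof -
  assume [measurable]: "A \<in> sets M"
  have [measurable]: "{x \<in> space M. piece m x \<in> S} \<in> sets M" by measurable
  show ?thesis unfolding perturb_def by measurable
qed

text \<open>\<open>A\<close> is changed exactly on the union of the selected pieces, and the piece
  of any given point is selected with probability \<open>e\<close>.\<close>

lemma sum_weight_measure_perturb: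
  assumes [measurable]: "A \<in> sets M"
  shows "(\<Sum>S\<in>Pow {..Suc m}. bernoulli_weight e {..Suc m} S * measure M (sym_diff A (perturb A m S))) = e"
proof -
  let ?R = "\<lambda>S. {x \<in> space M. piece m x \<in> S}"
  have eq: "sym_diff A (perturb A m S) = ?R S" for S
    using sets.sets_into_space[OF assms] by (auto simp: perturb_def)
  have [measurable]: "?R S \<in> sets M" for S by measurable
  have int: "integrable M (indicator (?R S) :: _ \<Rightarrow> real)" for S
    by (rule integrable_real_indicator) (simp_all add: emeasure_eq_measure)
  have "(\<Sum>S\<in>Pow {..Suc m}. bernoulli_weight e {..Suc m} S * measure M (?R S)) =
      (\<integral>x. (\<Sum>S\<in>Pow {..Suc m}. bernoulli_weight e {..Suc m} S * indicator (?R S) x) \<partial>M)"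
    using int by (subst Bochner_Integration.integral_sum) simp_all
  also have "\<dots> = (\<integral>x. e \<partial>M)"
  proof (rule Bochner_Integration.integral_cong)
    fix x assume "x \<in> space M"
    then have "(\<Sum>S\<in>Pow {..Suc m}. bernoulli_weight e {..Suc m} S * indicator (?R S) x) =
        (\<Sum>S\<in>Pow {..Suc m}. bernoulli_weight e {..Suc m} S * indicator S (piece m x))"
      by (intro sum.cong) (auto simp: indicator_def)
    also have "\<dots> = e" by (rule sum_bernoulli_weight_mem) (use piece_le in auto)
    finally show "(\<Sum>S\<in>Pow {..Suc m}. bernoulli_weight e {..Suc m} S * indicator (?R S) x) = e" .
  qed simp
  finally show ?thesis by (simp add: eq prob_space)
qed

text \<open>The factor that the point \<open>s\<close> contributes to the product of one cocycle
  with the conjugate of the other; \<open>flip\<close> tells whether the piece of the point is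
  selected.\<close>

definition hit_factor :: "complex \<Rightarrow> 'a set \<Rightarrow> bool \<Rightarrow> 'a \<times> 'a \<Rightarrow> nat + nat \<Rightarrow> complex" where
  "hit_factor c A flip z s =
     (if (orbit_pt s z \<in> A) = flip then 1 else case s of Inl _ \<Rightarrow> c | Inr _ \<Rightarrow> cnj c)"

lemma cocycle_perturb_prod:
  assumes "z \<in> space (M \<Otimes>\<^sub>M M)"
  shows "cocycle c (perturb A m S) n (fst z) * cnj (cocycle c (perturb A m S) n (snd z)) =
    (\<Prod>s\<in>orbit_idx n. if piece m (orbit_pt s z) \<in> S then hit_factor c A True z s else hit_factor c A False z s)"
proof -
  have sp: "orbit_pt s z \<in> space M" for s
    using measurable_space[OF orbit_pt_meas assms] .
  have *: "(if orbit_pt s z \<in> perturb A m S then u else 1) =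
      (if piece m (orbit_pt s z) \<in> S then (if orbit_pt s z \<in> A then 1 else u)
       else (if orbit_pt s z \<in> A then u else 1))" for s and u :: complex
    using sp[of s] by (auto simp: perturb_def)
  have "cocycle c (perturb A m S) n (fst z) = (\<Prod>i<n. if orbit_pt (Inl i) z \<in> perturb A m S then c else 1)"
    by (simp add: cocycle_def orbit_pt_def)
  moreover have "cnj (cocycle c (perturb A m S) n (snd z)) = (\<Prod>i<n. if orbit_pt (Inr i) z \<in> perturb A m S then cnj c else 1)"
    by (simp add: cocycle_def orbit_pt_def if_distrib cong: if_cong)
  ultimately show ?thesis
    unfolding * orbit_idx_def
    by (subst prod.Plus) (auto simp: hit_factor_def intro!: arg_cong2[where f="(*)"] prod.cong)
qed

text \<open>One alternative is 1 and the other \<open>c\<close> or its conjugate. Membership of the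
  point in \<open>A\<close> only swaps \<open>e\<close> and \<open>1 - e\<close>, in which the bound
  is symmetric.\<close>

lemma norm_mean_hit_factor_le:
  assumes c: "norm c = 1" and k: "1 - e * (1 - e) * (norm (c - 1))\<^sup>2 \<le> \<kappa>"
  shows "norm (of_real e * hit_factor c A True z s + of_real (1 - e) * hit_factor c A False z s) \<le> sqrt \<kappa>"
proof (rule real_le_rsqrt)
  define u where "u = (case s of Inl _ \<Rightarrow> c | Inr _ \<Rightarrow> cnj c)"
  have "norm (cnj c - 1) = norm (c - 1)" by (metis complex_cnj_diff complex_cnj_one complex_mod_cnj)
  then have u: "norm u = 1" "norm (u - 1) = norm (c - 1)"
    using c by (auto simp: u_def split: sum.split)
  show "(norm (of_real e * hit_factor c A True z s + of_real (1 - e) * hit_factor c A False z s))\<^sup>2 \<le> \<kappa>"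
    using norm_convex_comb_sq[OF u(1), of e] norm_convex_comb_sq[OF u(1), of "1 - e"] k u(2)
    by (auto simp: hit_factor_def u_def[symmetric] mult.commute add.commute)
qed

text \<open>
  The second moment of the correlation is a double integral over two orbit segments. Unless two
  of the \<open>2 n\<close> points involved share a piece, the random modifications along them are
  independent and the mean of the product factorises.
\<close>

lemma second_moment_corr_le:
  assumes c: "norm c = 1" and k: "1 - e * (1 - e) * (norm (c - 1))\<^sup>2 \<le> \<kappa>" "0 \<le> \<kappa>"
    and e: "0 \<le> e" "e \<le> 1" and [measurable]: "A \<in> sets M" "H \<in> sets M"
  shows "(\<Sum>S\<in>Pow {..Suc m}. bernoulli_weight e {..Suc m} S * (norm (corr c (perturb A m S) H n))\<^sup>2)
    \<le> \<kappa> ^ n + measure (M \<Otimes>\<^sub>M M) (collide n m)"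
proof -
  let ?w = "bernoulli_weight e {..Suc m}"
  define h :: "'a \<Rightarrow> complex" where "h x = indicator H x * indicator H ((T ^^ n) x)" for x
  define G where "G S z = cocycle c (perturb A m S) n (fst z) * cnj (cocycle c (perturb A m S) n (snd z))" for S z
  have w0: "0 \<le> ?w S" for S using e by (simp add: bernoulli_weight_def)
  have [measurable]: "h \<in> borel_measurable M" unfolding h_def[abs_def] by measurable
  have [measurable]: "G S \<in> borel_measurable (M \<Otimes>\<^sub>M M)" for S
    unfolding G_def[abs_def] by measurable
  have h1: "norm (h x) \<le> 1" for x by (simp add: h_def indicator_def)
  have h2: "norm (h x * cnj (h y)) \<le> 1" for x y
    using mult_mono[OF h1[of x] h1[of y]] by (simp add: norm_mult)
  have G1: "norm (G S z) = 1" for S z by (simp add: G_def norm_mult norm_cocycle[OF c])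
  have int: "integrable (M \<Otimes>\<^sub>M M) (\<lambda>z. h (fst z) * cnj (h (snd z)) * G S z)" for S
    by (rule MM.integrable_const_bound[of _ 1]) (use h2 G1 in \<open>auto simp: norm_mult\<close>)
  \<comment> \<open>The square of the norm is the integral times its conjugate, hence by Fubini one
    integral over pairs of starting points.\<close>
  have sq: "complex_of_real ((norm (corr c (perturb A m S) H n))\<^sup>2) =
      (\<integral>z. h (fst z) * cnj (h (snd z)) * G S z \<partial>(M \<Otimes>\<^sub>M M))" for S
  proof -
    let ?F = "\<lambda>x. h x * cocycle c (perturb A m S) n x"
    have "complex_of_real ((norm (corr c (perturb A m S) H n))\<^sup>2) =
        (\<integral>x. ?F x \<partial>M) * cnj (\<integral>x. ?F x \<partial>M)"
      unfolding complex_norm_square corr_def h_def ..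
    also have "\<dots> = (\<integral>x. (\<integral>y. ?F x * cnj (?F y) \<partial>M) \<partial>M)"
      by (simp only: integral_mult_right_zero integral_mult_left_zero Bochner_Integration.integral_cnj)
    also have "\<dots> = (\<integral>x. (\<integral>y. h (fst (x, y)) * cnj (h (snd (x, y))) * G S (x, y) \<partial>M) \<partial>M)"
      by (simp add: G_def mult_ac)
    also have "\<dots> = (\<integral>z. h (fst z) * cnj (h (snd z)) * G S z \<partial>(M \<Otimes>\<^sub>M M))"
      by (rule MM.integral_fst'[OF int])
    finally show ?thesis .
  qed
  let ?I = "\<lambda>z. \<Sum>S\<in>Pow {..Suc m}. of_real (?w S) * G S z"
  have I_le: "norm (?I z) \<le> \<kappa> ^ n + indicator (collide n m) z" if z: "z \<in> space (M \<Otimes>\<^sub>M M)" for z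
  proof (cases "z \<in> collide n m")
    case True
    have "norm (?I z) \<le> (\<Sum>S\<in>Pow {..Suc m}. ?w S)"
      using w0 by (intro sum_norm_le) (auto simp: norm_mult G1)
    also have "\<dots> = 1" by (rule sum_bernoulli_weight) simp
    finally show ?thesis using True k(2) by (simp add: add_increasing)
  next
    case False
    have inj: "inj_on (\<lambda>s. piece m (orbit_pt s z)) (orbit_idx n)"
      using False z unfolding collide_def inj_on_def by blast
    have "?I z = (\<Sum>S\<in>Pow {..Suc m}. of_real (?w S) *
        (\<Prod>s\<in>orbit_idx n. if piece m (orbit_pt s z) \<in> S then hit_factor c A True z s else hit_factor c A False z s))"
      unfolding G_def cocycle_perturb_prod[OF z] ..
    also have "\<dots> = (\<Prod>s\<in>orbit_idx n. of_real e * hit_factor c A True z s + of_real (1 - e) * hit_factor c A False z s)"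
      by (rule sum_bernoulli_weight_prod[OF _ _ inj]) (use piece_le in auto)
    \<comment> \<open>There are \<open>2 * n\<close> factors, one for each point of the two
      segments, so the square roots combine to \<open>\<kappa> ^ n\<close>.\<close>
    also have "norm \<dots> \<le> (\<Prod>s\<in>orbit_idx n. sqrt \<kappa>)"
      unfolding prod_norm[symmetric]
      by (intro prod_mono conjI norm_ge_zero norm_mean_hit_factor_le[OF c k(1)])
    also have "\<dots> = \<kappa> ^ n"
      using k(2) by (simp add: orbit_idx_def card_Plus power_add power_mult_distrib[symmetric])
    finally show ?thesis using False by simp
  qed
  let ?sum = "\<Sum>S\<in>Pow {..Suc m}. ?w S * (norm (corr c (perturb A m S) H n))\<^sup>2"
  have "complex_of_real ?sum = (\<Sum>S\<in>Pow {..Suc m}. of_real (?w S) * (\<integral>z. h (fst z) * cnj (h (snd z)) * G S z \<partial>(M \<Otimes>\<^sub>M M)))"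
    by (simp only: of_real_sum of_real_mult sq)
  also have "\<dots> = (\<integral>z. (\<Sum>S\<in>Pow {..Suc m}. of_real (?w S) * (h (fst z) * cnj (h (snd z)) * G S z)) \<partial>(M \<Otimes>\<^sub>M M))"
    using int by (subst Bochner_Integration.integral_sum) simp_all
  also have "\<dots> = (\<integral>z. h (fst z) * cnj (h (snd z)) * ?I z \<partial>(M \<Otimes>\<^sub>M M))"
    by (simp add: sum_distrib_left mult_ac)
  finally have "norm (complex_of_real ?sum) = norm (\<integral>z. h (fst z) * cnj (h (snd z)) * ?I z \<partial>(M \<Otimes>\<^sub>M M))"
    by simp
  also have "\<dots> \<le> (\<integral>z. \<kappa> ^ n + indicator (collide n m) z \<partial>(M \<Otimes>\<^sub>M M))"
  proof (rule integral_norm_bound_AE)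
    show "integrable (M \<Otimes>\<^sub>M M) (\<lambda>z. h (fst z) * cnj (h (snd z)) * ?I z)"
      unfolding sum_distrib_left using int
      by (intro Bochner_Integration.integrable_sum) (simp add: mult.left_commute[of _ "complex_of_real _"])
    show "integrable (M \<Otimes>\<^sub>M M) (\<lambda>z. \<kappa> ^ n + indicator (collide n m) z :: real)"
      by (simp add: MM.emeasure_eq_measure)
    show "AE z in M \<Otimes>\<^sub>M M. norm (h (fst z) * cnj (h (snd z)) * ?I z) \<le> \<kappa> ^ n + indicator (collide n m) z"
    proof (rule AE_I2)
      fix z assume "z \<in> space (M \<Otimes>\<^sub>M M)"
      have "norm (h (fst z) * cnj (h (snd z)) * ?I z) \<le> 1 * norm (?I z)"
        unfolding norm_mult[of _ "?I z"] using h2 by (intro mult_right_mono) auto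
      also have "\<dots> \<le> \<kappa> ^ n + indicator (collide n m) z" using I_le \<open>z \<in> _\<close> by simp
      finally show "norm (h (fst z) * cnj (h (snd z)) * ?I z) \<le> \<kappa> ^ n + indicator (collide n m) z" .
    qed
  qed
  also have "\<dots> = \<kappa> ^ n + measure (M \<Otimes>\<^sub>M M) (collide n m)"
    by (subst Bochner_Integration.integral_add) (simp_all add: MM.emeasure_eq_measure MM.prob_space)
  finally show ?thesis unfolding norm_of_real by (rule abs_le_D1)
qed

end

section \<open>Density\<close>

lemma square_times_power_tendsto_0:
  fixes \<kappa> :: real
  assumes "0 \<le> \<kappa>" "\<kappa> < 1"
  shows "(\<lambda>n. (real n)\<^sup>2 * \<kappa> ^ n) \<longlonglongrightarrow> 0"
proof -
  have "(\<lambda>n. (real n * sqrt \<kappa> ^ n)\<^sup>2) \<longlonglongrightarrow> 0\<^sup>2"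
    using assms by (intro tendsto_power powser_times_n_limit_0) simp
  moreover have "(real n * sqrt \<kappa> ^ n)\<^sup>2 = (real n)\<^sup>2 * \<kappa> ^ n" for n
    using assms by (simp add: power_mult_distrib power2_eq_square flip: power_mult_distrib)
  ultimately show ?thesis by simp
qed

context uniform_ergodic
begin

text \<open>Each of the \<open>n\<close> factors of the cocycle moves by at most
  \<open>norm (c - c')\<close>. This reduces uniformity in \<open>c\<close> to a finite net on the
  unit circle.\<close>

lemma norm_corr_lipschitz:
  assumes c: "norm c = 1" "norm c' = 1" and [measurable]: "B \<in> sets M" "H \<in> sets M"
  shows "norm (corr c B H n - corr c' B H n) \<le> n * norm (c - c')"
proof -
  let ?h = "\<lambda>x. indicator H x * indicator H ((T ^^ n) x) :: complex"
  have int: "integrable M (\<lambda>x. ?h x * cocycle c B n x)" if "norm c = 1" for c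
    by (rule integrable_const_bound[of _ 1])
      (auto simp: norm_mult norm_cocycle[OF that] indicator_def)
  have "norm (corr c B H n - corr c' B H n) =
      norm (\<integral>x. ?h x * cocycle c B n x - ?h x * cocycle c' B n x \<partial>M)"
    unfolding corr_def using c by (subst Bochner_Integration.integral_diff) (auto intro!: int)
  also have "\<dots> \<le> (\<integral>x. n * norm (c - c') \<partial>M)"
  proof (rule integral_norm_bound_AE)
    show "integrable M (\<lambda>x. ?h x * cocycle c B n x - ?h x * cocycle c' B n x)"
      using c by (intro Bochner_Integration.integrable_diff int)
    show "AE x in M. norm (?h x * cocycle c B n x - ?h x * cocycle c' B n x) \<le> n * norm (c - c')"
    proof (rule AE_I2)
      fix x
      have "norm (?h x * cocycle c B n x - ?h x * cocycle c' B n x)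
        \<le> norm (cocycle c B n x - cocycle c' B n x)"
        by (auto simp: indicator_def)
      also have "\<dots> \<le> (\<Sum>i<n. norm ((if (T ^^ Suc i) x \<in> B then c else 1) -
          (if (T ^^ Suc i) x \<in> B then c' else 1)))"
        unfolding cocycle_def by (rule norm_prod_diff) (auto simp: c)
      also have "\<dots> \<le> (\<Sum>i<n. norm (c - c'))"
        by (intro sum_mono) auto
      finally show "norm (?h x * cocycle c B n x - ?h x * cocycle c' B n x) \<le> n * norm (c - c')"
        by simp
    qed
  qed simp
  also have "\<dots> = n * norm (c - c')" by (simp add: prob_space)
  finally show ?thesis .
qed

text \<open>First moment method: the distance to \<open>A\<close> and all correlations at net points
  are scaled so that each is acceptable when its term is at most 1 (below 1 for the distance). The
  mean of their sum is less than 1, so some choice \<open>S\<close> meets all requirements at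
  once.\<close>

lemma exists_perturbation_small_corr:
  assumes A_meas [measurable]: "A \<in> sets M" and H_meas [measurable]: "H \<in> sets M"
    and pos: "e0 > 0" "\<theta> > 0" and \<delta>: "0 < \<delta>" "\<delta> \<le> 1" and J: "J \<ge> 1"
  shows "\<exists>B\<in>sets M. measure M (sym_diff A B) < e0 \<and>
    (\<exists>L\<ge>1. \<forall>c n. norm c = 1 \<and> norm (c - 1) \<ge> \<delta> \<and> n \<in> {L..L * J} \<longrightarrow> norm (corr c B H n) \<le> 2 * \<theta>)"
proof -
  define e where "e = min e0 1 / 2"
  have e: "0 < e" "e \<le> 1 / 2" "e / e0 \<le> 1 / 2" using pos by (auto simp: e_def field_simps)
  \<comment> \<open>Half of \<open>\<delta>\<close> appears because a net point near an admissible
    \<open>c\<close> is only known to be at distance \<open>\<delta> / 2\<close> from 1.\<close>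
  define \<kappa> where "\<kappa> = 1 - e * (1 - e) * (\<delta> / 2)\<^sup>2"
  have \<kappa>: "0 < \<kappa>" "\<kappa> < 1"
  proof -
    have "0 < e * (1 - e) * (\<delta> / 2)\<^sup>2" using e \<delta> by simp
    moreover have "e * (1 - e) * (\<delta> / 2)\<^sup>2 \<le> (1 / 2 * 1) * 1"
      using e \<delta> by (intro mult_mono power_le_one) auto
    ultimately show "0 < \<kappa>" "\<kappa> < 1" by (simp_all add: \<kappa>_def)
  qed
  obtain N where N: "2 * pi * J / \<theta> + 4 * pi / \<delta> < real N" using reals_Archimedean2 by blast
  have N_pos: "N \<ge> 1"
  proof -
    have "0 \<le> 2 * pi * J / \<theta> + 4 * pi / \<delta>" using pos \<delta> by simp
    then show ?thesis using N by linarith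
  qed
  have N1: "2 * pi * J / N \<le> \<theta>" and N2: "2 * pi / N \<le> \<delta> / 2"
  proof -
    have "0 \<le> 2 * pi * J / \<theta>" "0 \<le> 4 * pi / \<delta>" using pos \<delta> by simp_all
    then have "2 * pi * J / \<theta> \<le> real N" "4 * pi / \<delta> \<le> real N" using N by linarith+
    then show "2 * pi * J / N \<le> \<theta>" "2 * pi / N \<le> \<delta> / 2"
      using pos \<delta> N_pos by (simp_all add: field_simps)
  qed
  \<comment> \<open>With this weight, a term of at most 1 means a correlation of norm at most
    \<open>\<theta>\<close>.\<close>
  define X where "X = 1 / \<theta>\<^sup>2"
  have X: "X > 0" using pos by (simp add: X_def)
  \<comment> \<open>The number of pairs of a time and a net point grows like the square of
    \<open>L\<close>, each second moment decays like \<open>\<kappa> ^ L\<close>. The other half of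
    the budget 1 is reserved for \<open>e / e0\<close>.\<close>
  obtain L where L: "L \<ge> 1" "4 * J * N * X * ((real L)\<^sup>2 * \<kappa> ^ L) < 1 / 2"
  proof -
    have "(\<lambda>L. 4 * J * N * X * ((real L)\<^sup>2 * \<kappa> ^ L)) \<longlonglongrightarrow> 4 * J * N * X * 0"
      using \<kappa> by (intro tendsto_mult_left square_times_power_tendsto_0) auto
    then have "\<forall>\<^sub>F L in sequentially. 4 * J * N * X * ((real L)\<^sup>2 * \<kappa> ^ L) < 1 / 2"
      by (rule order_tendstoD) simp
    then have "\<forall>\<^sub>F L in sequentially. L \<ge> 1 \<and> 4 * J * N * X * ((real L)\<^sup>2 * \<kappa> ^ L) < 1 / 2"
      using eventually_ge_at_top[of 1] by eventually_elim auto
    from eventually_happens'[OF sequentially_bot this] show ?thesis using that by blast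
  qed
  \<comment> \<open>The mesh shrinks like \<open>1 / L\<close> because correlations in the window
    have Lipschitz constant up to \<open>L * J\<close> in \<open>c\<close>. The rounding error is
    then \<open>2 * pi * J / N\<close>, so \<open>N\<close> can be fixed before
    \<open>L\<close>.\<close>
  define net where "net = (\<lambda>k. cis (2 * pi * real k / real (N * L))) ` {..<N * L} \<inter> {c. norm (c - 1) \<ge> \<delta> / 2}"
  define \<Theta> where "\<Theta> = {L..L * J} \<times> net"
  have fin: "finite \<Theta>" by (simp add: \<Theta>_def net_def)
  have card_\<Theta>: "real (card \<Theta>) \<le> 2 * J * N * (real L)\<^sup>2"
  proof -
    have "card net \<le> card ((\<lambda>k. cis (2 * pi * real k / real (N * L))) ` {..<N * L})"
      unfolding net_def by (intro card_mono) auto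
    also have "\<dots> \<le> N * L" using card_image_le[of "{..<N * L}"] by simp
    finally have "card net \<le> N * L" .
    moreover have "card {L..L * J} \<le> 2 * (L * J)" using L J by simp
    ultimately have "card \<Theta> \<le> (2 * (L * J)) * (N * L)"
      unfolding \<Theta>_def card_cartesian_product by (intro mult_mono) auto
    then have "real (card \<Theta>) \<le> real ((2 * (L * J)) * (N * L))" by (rule of_nat_mono)
    then show ?thesis by (simp add: power2_eq_square mult_ac)
  qed
  \<comment> \<open>The pieces are chosen last: the window is now finite, and collisions at all of
    its times can be made as rare as the main term.\<close>
  have "\<forall>\<^sub>F m in sequentially. \<forall>n\<in>{L..L * J}. measure (M \<Otimes>\<^sub>M M) (collide n m) < \<kappa> ^ L"
    using \<kappa> by (intro eventually_ball_finite ballI order_tendstoD(2)[OF collide_tendsto_0]) auto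
  from eventually_happens'[OF sequentially_bot this]
  obtain m where m: "\<And>n. n \<in> {L..L * J} \<Longrightarrow> measure (M \<Otimes>\<^sub>M M) (collide n m) < \<kappa> ^ L"
    by blast
  let ?I = "{..Suc m}" and ?B = "perturb A m"
  let ?w = "bernoulli_weight e ?I"
  define \<Psi> where "\<Psi> S = measure M (sym_diff A (?B S)) / e0 +
      (\<Sum>(n, c)\<in>\<Theta>. X * (norm (corr c (?B S) H n))\<^sup>2)" for S
  have w0: "0 \<le> ?w S" for S using e by (simp add: bernoulli_weight_def)
  have moment: "(\<Sum>S\<in>Pow ?I. ?w S * (norm (corr c (?B S) H n))\<^sup>2) \<le> 2 * \<kappa> ^ L"
    if "(n, c) \<in> \<Theta>" for n c
  proof -
    have n: "n \<in> {L..L * J}" and c: "norm c = 1" "norm (c - 1) \<ge> \<delta> / 2"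
      using that by (auto simp: \<Theta>_def net_def)
    have "(\<delta> / 2)\<^sup>2 \<le> (norm (c - 1))\<^sup>2" using c \<delta> by (intro power_mono) auto
    then have "1 - e * (1 - e) * (norm (c - 1))\<^sup>2 \<le> \<kappa>"
      unfolding \<kappa>_def using e by (intro diff_left_mono mult_left_mono) auto
    then have "(\<Sum>S\<in>Pow ?I. ?w S * (norm (corr c (?B S) H n))\<^sup>2) \<le> \<kappa> ^ n + measure (M \<Otimes>\<^sub>M M) (collide n m)"
      using e \<kappa> by (intro second_moment_corr_le c) auto
    also have "\<dots> \<le> \<kappa> ^ L + \<kappa> ^ L"
      using m[OF n] n \<kappa> by (intro add_mono power_decreasing) auto
    finally show ?thesis by simp
  qed
  have "(\<Sum>S\<in>Pow ?I. ?w S * \<Psi> S) =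
      (\<Sum>S\<in>Pow ?I. ?w S * measure M (sym_diff A (?B S))) / e0 +
      (\<Sum>(n, c)\<in>\<Theta>. X * (\<Sum>S\<in>Pow ?I. ?w S * (norm (corr c (?B S) H n))\<^sup>2))"
  proof -
    have "(\<Sum>S\<in>Pow ?I. ?w S * \<Psi> S) = (\<Sum>S\<in>Pow ?I. ?w S * measure M (sym_diff A (?B S)) / e0 +
        (\<Sum>(n, c)\<in>\<Theta>. X * (?w S * (norm (corr c (?B S) H n))\<^sup>2)))"
      unfolding \<Psi>_def by (intro sum.cong) (auto simp: distrib_left sum_distrib_left mult_ac case_prod_beta)
    moreover have "(\<Sum>S\<in>Pow ?I. \<Sum>(n, c)\<in>\<Theta>. X * (?w S * (norm (corr c (?B S) H n))\<^sup>2)) =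
        (\<Sum>(n, c)\<in>\<Theta>. X * (\<Sum>S\<in>Pow ?I. ?w S * (norm (corr c (?B S) H n))\<^sup>2))"
      unfolding case_prod_beta sum_distrib_left by (rule sum.swap)
    ultimately show ?thesis by (simp only: sum.distrib sum_divide_distrib)
  qed
  also have "(\<Sum>S\<in>Pow ?I. ?w S * measure M (sym_diff A (?B S))) = e"
    by (rule sum_weight_measure_perturb) fact
  also have "(\<Sum>(n, c)\<in>\<Theta>. X * (\<Sum>S\<in>Pow ?I. ?w S * (norm (corr c (?B S) H n))\<^sup>2)) \<le>
      (\<Sum>(n, c)\<in>\<Theta>. X * (2 * \<kappa> ^ L))"
    using moment X by (intro sum_mono) (auto intro!: mult_left_mono)
  also have "(\<Sum>(n, c)\<in>\<Theta>. X * (2 * \<kappa> ^ L)) = card \<Theta> * (X * (2 * \<kappa> ^ L))"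
    by (simp add: case_prod_beta)
  also have "\<dots> \<le> 2 * J * N * (real L)\<^sup>2 * (X * (2 * \<kappa> ^ L))"
    using X \<kappa> card_\<Theta> by (intro mult_right_mono) auto
  also have "\<dots> = 4 * J * N * X * ((real L)\<^sup>2 * \<kappa> ^ L)" by (simp add: mult_ac)
  also have "e / e0 + 4 * J * N * X * ((real L)\<^sup>2 * \<kappa> ^ L) < 1" using e L by linarith
  finally have mean: "(\<Sum>S\<in>Pow ?I. ?w S * \<Psi> S) < 1" by simp
  have "\<exists>S. \<Psi> S < 1"
  proof (rule ccontr)
    assume "\<not> ?thesis"
    then have "(\<Sum>S\<in>Pow ?I. ?w S * 1) \<le> (\<Sum>S\<in>Pow ?I. ?w S * \<Psi> S)"
      using w0 by (intro sum_mono mult_left_mono) (auto simp: not_less)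
    then show False using mean sum_bernoulli_weight[of ?I e] by simp
  qed
  then obtain S where S: "\<Psi> S < 1" ..
  have sum0: "0 \<le> (\<Sum>(n, c)\<in>\<Theta>. X * (norm (corr c (?B S) H n))\<^sup>2)"
    using X by (intro sum_nonneg) auto
  have "measure M (sym_diff A (?B S)) / e0 < 1" using S sum0 by (simp add: \<Psi>_def)
  then have small: "measure M (sym_diff A (?B S)) < e0" using pos by (simp add: field_simps)
  have net_small: "norm (corr c (?B S) H n) \<le> \<theta>" if "(n, c) \<in> \<Theta>" for n c
  proof -
    have "X * (norm (corr c (?B S) H n))\<^sup>2 \<le> (\<Sum>(n, c)\<in>\<Theta>. X * (norm (corr c (?B S) H n))\<^sup>2)"
      using member_le_sum[OF that, of "\<lambda>(n, c). X * (norm (corr c (?B S) H n))\<^sup>2"] X fin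
      by (simp add: case_prod_beta)
    also have "\<dots> \<le> \<Psi> S" using pos by (simp add: \<Psi>_def)
    finally have "X * (norm (corr c (?B S) H n))\<^sup>2 \<le> 1" using S by simp
    then have "(norm (corr c (?B S) H n))\<^sup>2 \<le> \<theta>\<^sup>2" using pos by (simp add: X_def divide_le_eq)
    then show ?thesis by (rule power2_le_imp_le) (use pos in simp)
  qed
  have "norm (corr c (?B S) H n) \<le> 2 * \<theta>"
    if c: "norm c = 1" "norm (c - 1) \<ge> \<delta>" and n: "n \<in> {L..L * J}" for c n
  proof -
    have NL: "N * L \<ge> 1" using N_pos L by simp
    obtain k where k: "k < N * L" "norm (c - cis (2 * pi * real k / real (N * L))) \<le> 2 * pi / real (N * L)"
      using unit_circle_net[OF c(1) NL] by blast
    define c' where "c' = cis (2 * pi * real k / real (N * L))"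
    have c': "norm c' = 1" "norm (c - c') \<le> 2 * pi / real (N * L)" using k by (simp_all add: c'_def)
    have "2 * pi / real (N * L) \<le> 2 * pi / N"
      using L N_pos by (intro divide_left_mono) auto
    with c' N2 have "norm (c - c') \<le> \<delta> / 2" by linarith
    moreover have "norm (c - 1) \<le> norm (c - c') + norm (c' - 1)"
      using norm_triangle_ineq[of "c - c'" "c' - 1"] by simp
    ultimately have "norm (c' - 1) \<ge> \<delta> / 2" using c(2) by linarith
    then have "(n, c') \<in> \<Theta>" using n k by (auto simp: \<Theta>_def net_def c'_def)
    then have "norm (corr c' (?B S) H n) \<le> \<theta>" by (rule net_small)
    moreover have "norm (corr c (?B S) H n - corr c' (?B S) H n) \<le> \<theta>"
    proof -
      have "norm (corr c (?B S) H n - corr c' (?B S) H n) \<le> n * norm (c - c')"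
        using c c' by (intro norm_corr_lipschitz) auto
      also have "\<dots> \<le> real (L * J) * (2 * pi / real (N * L))"
      proof (rule mult_mono)
        show "real n \<le> real (L * J)" using n by (simp only: of_nat_le_iff atLeastAtMost_iff)
      qed (use c' in auto)
      also have "\<dots> = 2 * pi * J / N" using L by (simp add: field_simps)
      finally show ?thesis using N1 by linarith
    qed
    ultimately show ?thesis
      using norm_triangle_sub[of "corr c (?B S) H n" "corr c' (?B S) H n"] by linarith
  qed
  then show ?thesis using small L(1) by (intro bexI[of _ "?B S"]) auto
qed

lemma decorrelated_dense:
  assumes A_meas [measurable]: "A \<in> sets M" and e0: "e0 > 0"
  shows "\<exists>B\<in>sets M. measure M (sym_diff A B) < e0 \<and>
    (\<exists>d>0. \<forall>C\<in>sets M. measure M (sym_diff B C) < d \<longrightarrow> decorrelated q k J C)"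
proof -
  let ?H = "{x \<in> space M. \<psi> x \<le> q}"
  \<comment> \<open>The set \<open>B\<close> has correlations up to \<open>2 * \<theta>\<close>, and
    passing to a nearby \<open>C\<close> costs another \<open>2 * \<theta>\<close>; together this is
    \<open>1 / Suc J\<close>.\<close>
  define \<theta> where "\<theta> = 1 / (4 * real (Suc J))"
  have \<theta>: "\<theta> > 0" by (simp add: \<theta>_def)
  have H: "?H \<in> sets M" by measurable
  obtain B L where B [measurable]: "B \<in> sets M" and "measure M (sym_diff A B) < e0" and L: "L \<ge> 1"
    and small: "\<And>c n. norm c = 1 \<Longrightarrow> norm (c - 1) \<ge> 1 / Suc k \<Longrightarrow> n \<in> {L..L * Suc J} \<Longrightarrow>
      norm (corr c B ?H n) \<le> 2 * \<theta>"
    using exists_perturbation_small_corr[OF A_meas H e0 \<theta>, of "1 / Suc k" "Suc J"] by auto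
  moreover have "decorrelated q k J C"
    if C: "C \<in> sets M" and d: "measure M (sym_diff B C) < \<theta> / (L * Suc J)" for C
    unfolding decorrelated_def
  proof (intro exI[of _ L] allI impI, elim conjE)
    fix c :: complex and n assume c: "norm c = 1" "norm (c - 1) \<ge> 1 / Suc k" and n: "n \<in> {L..L * Suc J}"
    have "norm (corr c B ?H n - corr c C ?H n) \<le> 2 * real n * measure M (sym_diff B C)"
      by (rule norm_corr_diff_le[OF c(1) B C H])
    also have "\<dots> \<le> 2 * real (L * Suc J) * (\<theta> / (L * Suc J))"
      using n d by (intro mult_mono) (simp_all del: of_nat_mult mult_Suc_right)
    also have "\<dots> = 2 * \<theta>"
    proof -
      have "2 * y * (\<theta> / y) = 2 * \<theta>" if "y \<noteq> 0" for y :: real using that by simp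
      then show ?thesis using L by (metis One_nat_def Suc_le_eq mult_is_0 nat.distinct(1) not_less0 of_nat_eq_0_iff)
    qed
    finally have "norm (corr c C ?H n) \<le> 4 * \<theta>"
      using small[OF c n] norm_triangle_sub[of "corr c C ?H n" "corr c B ?H n"]
      by (simp add: norm_minus_commute)
    also have "4 * \<theta> = 1 / Suc J" unfolding \<theta>_def by (simp del: of_nat_Suc)
    finally show "norm (corr c C ?H n) \<le> 1 / Suc J" .
  qed
  moreover have "\<theta> / (L * Suc J) > 0"
  proof -
    have "0 < L * Suc J" using L by simp
    then show ?thesis using \<theta> by (simp only: of_nat_0_less_iff zero_less_divide_iff simp_thms)
  qed
  ultimately show ?thesis by blast
qed

lemma residual_weakly_mixing:
  "residual_in (algebra_topology M)
     {null_class M A | A. A \<in> sets M \<and> emeasure M A > 0 \<and>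
        weakly_mixing (normalized_on M A) (induced T A)}"
proof (rule residual_in_algebra_topologyI)
  show "countable (\<rat> \<times> (UNIV :: nat set) \<times> (UNIV :: nat set) :: (real \<times> nat \<times> nat) set)"
    by (intro countable_SIGMA countable_rat) auto
  fix A e and p :: "real \<times> nat \<times> nat" assume "A \<in> sets M" "(e::real) > 0"
  then show "\<exists>B\<in>sets M. measure M (sym_diff A B) < e \<and>
    (\<exists>d>0. \<forall>C\<in>sets M. measure M (sym_diff B C) < d \<longrightarrow> (case p of (q, k, J) \<Rightarrow> decorrelated q k J) C)"
    using decorrelated_dense by (cases p) simp
next
  fix A assume A: "A \<in> sets M"
    and *: "\<And>p. p \<in> \<rat> \<times> UNIV \<times> UNIV \<Longrightarrow> (case p of (q, k, J) \<Rightarrow> decorrelated q k J) A"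
  have dec: "decorrelated q k J A" if "q \<in> \<rat>" for q k J
    using *[of "(q, k, J)"] that by simp
  show "emeasure M A > 0 \<and> weakly_mixing (normalized_on M A) (induced T A)"
    using weakly_mixing_induced[OF A dec] measure_pos_if_decorrelated[OF A dec]
    by (simp add: emeasure_eq_measure zero_less_measure_iff)
qed

end

section \<open>Standard spaces and automorphisms\<close>

text \<open>Restricted to \<open>D\<close>, the preimage of \<open>B\<close> is mapped onto
  \<open>B \<inter> T\<close> D\<open>, and\<close>T \<open>D\<close> is conull; preservation of
  measure by images thus gives preservation by preimages.\<close>

lemma (in prob_space) automorphism_distr:
  assumes "automorphism M T"
  shows "distr M M T = M"
proof (rule measure_eqI)
  obtain D where T [measurable]: "T \<in> M \<rightarrow>\<^sub>M M" and D: "D \<in> sets M" "inj_on T D"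
    and img: "\<And>A. A \<in> sets M \<Longrightarrow> T ` (A \<inter> D) \<in> sets M"
      "\<And>A. A \<in> sets M \<Longrightarrow> emeasure M (T ` (A \<inter> D)) = emeasure M A"
    using assms by (auto simp: automorphism_def invertibility_domain_def)
  have [simp]: "space M \<inter> D = D" using sets.sets_into_space[OF D(1)] by blast
  have TD: "T ` D \<in> sets M" "emeasure M (T ` D) = 1"
    using img[of "space M"] by (simp_all add: emeasure_space_1)
  then have ae: "AE x in M. x \<in> T ` D"
    using prob_eq_1[OF TD(1)] by (simp add: emeasure_eq_measure)
  fix B assume "B \<in> sets (distr M M T)"
  then have B [measurable]: "B \<in> sets M" by simp
  have "emeasure (distr M M T) B = emeasure M (T -` B \<inter> space M)"
    by (rule emeasure_distr) measurable
  also have "\<dots> = emeasure M (T ` ((T -` B \<inter> space M) \<inter> D))"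
    by (rule img(2)[symmetric]) measurable
  also have "T ` ((T -` B \<inter> space M) \<inter> D) = B \<inter> T ` D"
    using sets.sets_into_space[OF D(1)] by blast
  also have "emeasure M \<dots> = emeasure M B"
    using ae TD(1) by (intro emeasure_eq_AE) auto
  finally show "emeasure (distr M M T) B = emeasure M B" .
qed simp

text \<open>Passes from preimages to the images in the definition of ergodicity: \<open>T\<close> (A
  \<inter> D)\<open>and\<close>A\<open>differ only on the image of the null set\<close>Z \<inter>
  D\<open>and outside the conull set\<close>T \<open>D\<close>.\<close>

lemma (in prob_space) ergodic_AE:
  assumes "automorphism M T" "ergodic M T" "A \<in> sets M"
    and inv: "AE x in M. T x \<in> A \<longleftrightarrow> x \<in> A"
  shows "(AE x in M. x \<in> A) \<or> (AE x in M. x \<notin> A)"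
proof -
  obtain D where T [measurable]: "T \<in> M \<rightarrow>\<^sub>M M" and dom: "invertibility_domain M T D"
    using assms(1) by (auto simp: automorphism_def)
  then have D: "D \<in> sets M" "inj_on T D"
    and img: "\<And>A. A \<in> sets M \<Longrightarrow> T ` (A \<inter> D) \<in> sets M"
      "\<And>A. A \<in> sets M \<Longrightarrow> emeasure M (T ` (A \<inter> D)) = emeasure M A"
    by (auto simp: invertibility_domain_def)
  note A [measurable] = assms(3)
  have [simp]: "space M \<inter> D = D" using sets.sets_into_space[OF D(1)] by blast
  have TD: "T ` D \<in> sets M" "emeasure M (T ` D) = 1"
    using img[of "space M"] by (simp_all add: emeasure_space_1)
  define Z where "Z = {x \<in> space M. \<not> (T x \<in> A \<longleftrightarrow> x \<in> A)}"
  have Z: "Z \<in> sets M" unfolding Z_def by measurable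
  have "emeasure M Z = 0"
    using inv AE_iff_measurable[OF Z, of "\<lambda>x. T x \<in> A \<longleftrightarrow> x \<in> A"] by (simp add: Z_def)
  then have "T ` (Z \<inter> D) \<in> null_sets M" using img[OF Z] by (simp add: null_sets_def)
  moreover have "space M - T ` D \<in> null_sets M"
    using TD by (simp add: null_sets_def emeasure_compl emeasure_space_1)
  ultimately have "T ` (Z \<inter> D) \<union> (space M - T ` D) \<in> null_sets M" by blast
  moreover have "sym_diff (T ` (A \<inter> D)) A \<in> sets M" using img(1)[OF A] by measurable
  moreover have "sym_diff (T ` (A \<inter> D)) A \<subseteq> T ` (Z \<inter> D) \<union> (space M - T ` D)"
  proof
    fix y assume y: "y \<in> sym_diff (T ` (A \<inter> D)) A"
    show "y \<in> T ` (Z \<inter> D) \<union> (space M - T ` D)"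
    proof (cases "y \<in> T ` D")
      case True
      then obtain x where "x \<in> D" "y = T x" by blast
      moreover from this have "x \<in> space M" using sets.sets_into_space[OF D(1)] by blast
      ultimately have "x \<in> Z \<inter> D"
        using y D(2) by (auto simp: Z_def inj_on_def)
      then show ?thesis using \<open>y = T x\<close> by blast
    next
      case False
      then show ?thesis using y sets.sets_into_space[OF A] by blast
    qed
  qed
  ultimately have "sym_diff (T ` (A \<inter> D)) A \<in> null_sets M" using null_sets_subset by metis
  then have "A \<in> null_sets M \<or> space M - A \<in> null_sets M"
    using assms(2) dom A unfolding ergodic_def by blast
  then show ?thesis
  proof
    assume "A \<in> null_sets M"
    then show ?thesis by (auto intro: AE_not_in)
  next
    assume "space M - A \<in> null_sets M"
    then have "AE x in M. x \<notin> space M - A" by (rule AE_not_in)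
    then have "AE x in M. x \<in> A" using AE_space by eventually_elim auto
    then show ?thesis ..
  qed
qed

text \<open>The isomorphism onto the interval respects only the completed measure;
  \<open>\<psi>\<close> is a version of it that is measurable for \<open>M\<close> itself.\<close>

lemma nonatomic_lebesgue_coordinate:
  assumes "nonatomic_lebesgue_prob_space M"
  obtains \<psi> :: "'a \<Rightarrow> real" where "\<psi> \<in> borel_measurable M" "AE x in M. \<psi> x \<in> {0..1}"
    "\<And>a b. a \<le> b \<Longrightarrow> measure M {x \<in> space M. \<psi> x \<in> {a..b}} \<le> b - a"
    "\<And>E. E \<in> sets M \<Longrightarrow> \<exists>C\<in>sets borel. AE x in M. x \<in> E \<longleftrightarrow> \<psi> x \<in> C"
proof -
  interpret prob_space M using assms by (simp add: nonatomic_lebesgue_prob_space_def)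
  let ?C = "completion M" and ?N = "lebesgue_on {0..1::real}"
  obtain X Y \<phi> where X: "X \<in> sets ?C" "space M - X \<in> null_sets ?C"
    and Y: "Y \<in> sets ?N" and bij: "bij_betw \<phi> X Y"
    and sets_iff: "\<And>A. A \<subseteq> X \<Longrightarrow> A \<in> sets ?C \<longleftrightarrow> \<phi> ` A \<in> sets ?N"
    and meas: "\<And>A. A \<subseteq> X \<Longrightarrow> A \<in> sets ?C \<Longrightarrow> emeasure ?N (\<phi> ` A) = emeasure ?C A"
    using assms unfolding nonatomic_lebesgue_prob_space_def iso_mod_null_def by auto
  have Xsp: "X \<subseteq> space M" using sets.sets_into_space[OF X(1)] by simp
  have Y01: "Y \<subseteq> {0..1}" using sets.sets_into_space[OF Y] by simp
  have setsN: "A \<in> sets ?N \<longleftrightarrow> A \<in> sets lebesgue \<and> A \<subseteq> {0..1}" for A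
    by (auto simp: sets_restrict_space_iff)
  have img: "\<phi> ` (\<phi> -` B \<inter> X) = B \<inter> Y" for B
    using bij by (auto simp: bij_betw_def)
  have BY: "B \<inter> Y \<in> sets ?N" if "B \<in> sets borel" for B
    using Y Y01 that by (auto simp: setsN)
  have pre: "\<phi> -` B \<inter> X \<in> sets ?C" if "B \<in> sets borel" for B
    using sets_iff[of "\<phi> -` B \<inter> X"] BY[OF that] by (simp add: img)
  have pre_le: "emeasure ?C (\<phi> -` B \<inter> X) \<le> emeasure lborel B" if B: "B \<in> sets borel" for B
  proof -
    have "emeasure ?C (\<phi> -` B \<inter> X) = emeasure ?N (B \<inter> Y)"
      using meas[of "\<phi> -` B \<inter> X"] pre[OF B] by (simp add: img)
    also have "\<dots> = emeasure lebesgue (B \<inter> Y)"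
      using Y01 by (intro emeasure_restrict_space) auto
    also have "\<dots> \<le> emeasure lebesgue B" using B by (intro emeasure_mono) auto
    also have "\<dots> = emeasure lborel B" using B by simp
    finally show ?thesis .
  qed
  \<comment> \<open>Off \<open>X\<close> the values of \<open>\<phi>\<close> are arbitrary; the
    default 0 there gives measurability and matters only on a null set.\<close>
  define \<phi>' where "\<phi>' x = (if x \<in> X then \<phi> x else 0)" for x
  have "\<phi>' \<in> borel_measurable ?C"
  proof (rule measurableI)
    fix B :: "real set" assume B: "B \<in> sets borel"
    have "\<phi>' -` B \<inter> space ?C = (\<phi> -` B \<inter> X) \<union> (if 0 \<in> B then space M - X else {})"
      using Xsp by (auto simp: \<phi>'_def split: if_splits)
    also have "\<dots> \<in> sets ?C" using pre[OF B] X by auto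
    finally show "\<phi>' -` B \<inter> space ?C \<in> sets ?C" .
  qed simp
  then obtain \<psi> where \<psi> [measurable]: "\<psi> \<in> borel_measurable M" and eq: "AE x in M. \<phi>' x = \<psi> x"
    using completion_ex_borel_measurable_real by blast
  have "AE x in M. x \<notin> space M - X"
    using AE_not_in[OF X(2)] by (simp only: AE_completion_iff)
  then have eq: "AE x in M. x \<in> X \<and> \<psi> x = \<phi> x"
    using eq AE_space by eventually_elim (auto simp: \<phi>'_def)
  show thesis
  proof (rule that[OF \<psi>])
    have "\<phi> x \<in> {0..1}" if "x \<in> X" for x
      using that bij Y01 by (auto simp: bij_betw_def)
    with eq show "AE x in M. \<psi> x \<in> {0..1}" by (auto elim!: AE_mp)
    fix a b :: real assume ab: "a \<le> b"
    have "emeasure M {x \<in> space M. \<psi> x \<in> {a..b}} = emeasure ?C {x \<in> space M. \<psi> x \<in> {a..b}}"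
      by (subst emeasure_completion) auto
    also have "\<dots> = emeasure ?C (\<phi> -` {a..b} \<inter> X)"
    proof (rule emeasure_eq_AE)
      show "AE x in ?C. x \<in> {x \<in> space M. \<psi> x \<in> {a..b}} \<longleftrightarrow> x \<in> \<phi> -` {a..b} \<inter> X"
        unfolding AE_completion_iff using eq AE_space by eventually_elim auto
    qed (use pre in auto)
    also have "\<dots> \<le> emeasure lborel {a..b}" by (rule pre_le) simp
    finally show "measure M {x \<in> space M. \<psi> x \<in> {a..b}} \<le> b - a"
      using ab by (simp add: emeasure_eq_measure)
  next
    fix E assume E: "E \<in> sets M"
    have "E \<inter> X \<in> sets ?C" using E X by auto
    then have "\<phi> ` (E \<inter> X) \<in> sets lebesgue" using sets_iff[of "E \<inter> X"] setsN by auto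
    \<comment> \<open>The image of \<open>E\<close> is only Lebesgue measurable. Its Borel part
      \<open>S\<close> serves as the set sought, since the preimage of the Borel null set
      \<open>R'\<close> is null.\<close>
    then obtain S R R' where C: "\<phi> ` (E \<inter> X) = S \<union> R" "R \<subseteq> R'" "R' \<in> null_sets lborel" "S \<in> sets lborel"
      by (rule sets_completionE)
    have "emeasure ?C (\<phi> -` R' \<inter> X) \<le> 0"
      using pre_le[of R'] C(3) by (auto simp: null_sets_def)
    then have null: "\<phi> -` R' \<inter> X \<in> null_sets ?C"
      using pre[of R'] C(3) by (auto simp: null_sets_def)
    have "AE x in M. x \<notin> \<phi> -` R' \<inter> X"
      using AE_not_in[OF null] by (simp only: AE_completion_iff)
    with eq have "AE x in M. x \<in> E \<longleftrightarrow> \<psi> x \<in> S"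
    proof eventually_elim
      case (elim x)
      have "x \<in> E \<longleftrightarrow> \<phi> x \<in> \<phi> ` (E \<inter> X)"
        using elim bij by (auto simp: bij_betw_def inj_on_def)
      then show ?case using elim C(1,2) by auto
    qed
    then show "\<exists>C\<in>sets borel. AE x in M. x \<in> E \<longleftrightarrow> \<psi> x \<in> C"
      using C(4) by (intro bexI[of _ S]) auto
  qed
qed

theorem corollary1:
  fixes M :: "'a measure" and T :: "'a \<Rightarrow> 'a"
  assumes "nonatomic_lebesgue_prob_space M"
    and "automorphism M T"
    and "ergodic M T"
  shows "residual_in (algebra_topology M)
           {null_class M A | A. A \<in> sets M \<and> emeasure M A > 0 \<and>
              weakly_mixing (normalized_on M A) (induced T A)}"
proof -
  interpret prob_space M using assms(1) by (simp add: nonatomic_lebesgue_prob_space_def)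
  obtain \<psi> :: "'a \<Rightarrow> real" where \<psi>: "\<psi> \<in> borel_measurable M" "AE x in M. \<psi> x \<in> {0..1}"
    "\<And>a b. a \<le> b \<Longrightarrow> measure M {x \<in> space M. \<psi> x \<in> {a..b}} \<le> b - a"
    "\<And>E. E \<in> sets M \<Longrightarrow> \<exists>C\<in>sets borel. AE x in M. x \<in> E \<longleftrightarrow> \<psi> x \<in> C"
    using nonatomic_lebesgue_coordinate[OF assms(1)] by blast
  interpret uniform_ergodic M T \<psi>
  proof
    show "T \<in> M \<rightarrow>\<^sub>M M" using assms(2) by (simp add: automorphism_def)
    show "distr M M T = M" using assms(2) by (rule automorphism_distr)
  qed (use \<psi> ergodic_AE[OF assms(2,3)] in blast)+
  show ?thesis by (rule residual_weakly_mixing)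
qed

end
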